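(* Let $F_A$ be the free group on a finite set $A$ and let $\varphi \in \mathrm{Aut}(F_A)$. Then the following conditions are equivalent: (i) $\varphi$ satisfies a Lipschitz condition for every visual metric on $F_A$; (ii) $\varphi \in \mathrm{Inn}(F_A)$ or $|A| \leq 1$.
   Context: Maps are written on the right; $\mathrm{Inn}(F_A)$ is the group of inner automorphisms of $F_A$. For a finite generating set $B$ of $G=F_A$ (not necessarily a basis), $d_B$ denotes the word metric on $G$ with respect to $B\cup B^{-1}$. Gromov product: $(g|h)_p^B = \frac12(d_B(p,g)+d_B(p,h)-d_B(g,h))$. Let $\rho^B_{p,\gamma}(g,h) = e^{-\gamma (g|h)_p^B}$ if $g \ne h$ and $0$ otherwise. For $p \in G$, $\gamma>0$, $T\ge 1$, $V^B(p,\gamma,T)$ is the set of all metrics $d$ on $G$ with $\frac1T\rho^B_{p,\gamma}(g,h) \le d(g,h) \le T\rho^B_{p,\gamma}(g,h)$ for all distinct $g,h\in G$. A visual metric on $G$ is a metric belonging to $V^B(p,\gamma,T)$ for some finite generating set $B$ and some $p\in G$, $\gamma>0$, $T\ge1$. $\varphi$ satisfies a Lipschitz condition for $d$ if there is $K>0$ with $d(g\varphi,h\varphi)\le K\,d(g,h)$ for all $g,h\in G$. *)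

theory Defs
  imports "HOL-Algebra.Algebra" "HOL-Analysis.Abstract_Metric_Spaces"
begin

section \<open>The free group on a set\<close>

text \<open>The letter \<open>(a, True)\<close> stands for the generator \<open>a\<close> and \<open>(a, False)\<close> for its formal
  inverse. The free group consists of the reduced words, and the product of two reduced words is
  the reduced form of their concatenation.\<close>

type_synonym 'a letter = "'a \<times> bool"

definition flip :: "'a letter \<Rightarrow> 'a letter" where
  "flip x = (fst x, \<not> snd x)"

definition reduced :: "'a letter list \<Rightarrow> bool" where
  "reduced = successively (\<lambda>x y. y \<noteq> flip x)"

fun push :: "'a letter \<Rightarrow> 'a letter list \<Rightarrow> 'a letter list" where
  "push x [] = [x]"
| "push x (y # w) = (if y = flip x then w else x # y # w)"

definition reduce :: "'a letter list \<Rightarrow> 'a letter list" where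
  "reduce w = foldr push w []"

definition free_group :: "'a set \<Rightarrow> 'a letter list monoid" where
  "free_group A =
    \<lparr>carrier = {w. reduced w \<and> fst ` set w \<subseteq> A},
     monoid.mult = (\<lambda>u v. reduce (u @ v)),
     one = []\<rparr>"

lemma flip_flip [simp]: "flip (flip x) = x"
  by (simp add: flip_def)

lemma fst_flip [simp]: "fst (flip x) = fst x"
  by (simp add: flip_def)

lemma reduced_Nil [simp]: "reduced []"
  by (simp add: reduced_def)

lemma reduced_push: "reduced w \<Longrightarrow> reduced (push x w)"
  by (cases w) (auto simp: reduced_def successively_Cons)

lemma push_flip: "reduced w \<Longrightarrow> push x (push (flip x) w) = w"
  by (cases w; cases "tl w") (auto simp: reduced_def successively_Cons)

lemma reduced_foldr_push: "reduced u \<Longrightarrow> reduced (foldr push w u)"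
  by (induction w) (auto simp: reduced_push)

lemma reduced_reduce: "reduced (reduce w)"
  by (simp add: reduce_def reduced_foldr_push)

lemma set_push: "set (push x w) \<subseteq> insert x (set w)"
  by (cases w) auto

lemma set_reduce: "set (reduce w) \<subseteq> set w"
  unfolding reduce_def using set_push by (induction w) fastforce+

lemma reduce_reduced: "reduced w \<Longrightarrow> reduce w = w"
proof (induction w)
  case (Cons x w)
  then show ?case
    by (cases w) (auto simp: reduce_def reduced_def successively_Cons)
qed (simp add: reduce_def)

lemma foldr_push_push:
  assumes "reduced u"
  shows "foldr push (push x v) u = push x (foldr push v u)"
proof (cases v)
  case (Cons y w)
  then show ?thesis
    using push_flip[of "foldr push w u" x] assms by (auto simp: reduced_foldr_push)
qed simp

lemma foldr_push_reduce: "reduced u \<Longrightarrow> foldr push (reduce w) u = foldr push w u"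
  by (induction w) (auto simp: reduce_def foldr_push_push)

lemma reduce_append: "reduce (u @ v) = foldr push u (reduce v)"
  by (simp add: reduce_def)

lemma reduce_append_left: "reduce (reduce u @ v) = reduce (u @ v)"
  by (simp add: reduce_append foldr_push_reduce reduced_reduce)

lemma reduce_append_right: "reduce (u @ reduce v) = reduce (u @ v)"
  by (simp add: reduce_append reduce_reduced reduced_reduce)

lemma reduce_inverse: "reduce (rev (map flip w) @ w) = []"
proof (induction w)
  case (Cons x w)
  have "push (flip x) (push x (reduce w)) = reduce w"
    using push_flip[of "reduce w" "flip x"] by (simp add: reduced_reduce)
  then show ?case
    using Cons.IH by (simp add: reduce_append) (simp add: reduce_def)
qed (simp add: reduce_def)

lemma reduced_inverse:
  assumes "reduced w"
  shows "reduced (rev (map flip w))"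
  using assms unfolding reduced_def
  by (auto simp: successively_map elim: successively_mono)

lemma group_free_group: "group (free_group A)"
proof (rule groupI)
  fix u v assume "u \<in> carrier (free_group A)" "v \<in> carrier (free_group A)"
  then show "u \<otimes>\<^bsub>free_group A\<^esub> v \<in> carrier (free_group A)"
    using set_reduce[of "u @ v"] by (fastforce simp: free_group_def reduced_reduce)
next
  fix u assume u: "u \<in> carrier (free_group A)"
  have "fst ` set (rev (map flip u)) = fst ` set u"
    by (simp add: image_image)
  then have "rev (map flip u) \<in> carrier (free_group A)"
    using u by (simp add: free_group_def reduced_inverse del: set_rev set_map)
  then show "\<exists>v\<in>carrier (free_group A). v \<otimes>\<^bsub>free_group A\<^esub> u = \<one>\<^bsub>free_group A\<^esub>"
    by (rule bexI[rotated]) (simp add: free_group_def reduce_inverse)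
qed (auto simp: free_group_def reduce_append_left reduce_append_right reduce_reduced)

lemma free_group_universal:
  assumes H: "group H" and f: "f \<in> A \<rightarrow> carrier H"
  shows "\<exists>h\<in>hom (free_group A) H. (\<forall>a\<in>A. h [(a, True)] = f a) \<and>
    (\<forall>k\<in>hom (free_group A) H. (\<forall>a\<in>A. k [(a, True)] = f a) \<longrightarrow>
      (\<forall>w\<in>carrier (free_group A). k w = h w))"
proof -
  interpret H: group H by fact
  interpret F: group "free_group A" by (rule group_free_group)
  define l where "l = (\<lambda>x. if snd x then f (fst x) else inv\<^bsub>H\<^esub> f (fst x))"
  define h where "h = (\<lambda>w. foldr (\<lambda>x y. l x \<otimes>\<^bsub>H\<^esub> y) w \<one>\<^bsub>H\<^esub>)"
  have l: "l x \<in> carrier H" if "fst x \<in> A" for x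
    using that f by (auto simp: l_def)
  have h: "h w \<in> carrier H" if "fst ` set w \<subseteq> A" for w
    using that by (induction w) (auto simp: h_def l)
  have h_append: "h (u @ v) = h u \<otimes>\<^bsub>H\<^esub> h v" if "fst ` set u \<subseteq> A" "fst ` set v \<subseteq> A" for u v
    using that
  proof (induction u)
    case (Cons x u)
    then have "l x \<in> carrier H" "h u \<in> carrier H" "h v \<in> carrier H"
      by (auto intro: l h)
    with Cons show ?case
      by (simp add: h_def H.m_assoc)
  qed (use h[of v] in \<open>simp add: h_def\<close>)
  have h_push: "h (push x w) = l x \<otimes>\<^bsub>H\<^esub> h w" if "fst x \<in> A" "fst ` set w \<subseteq> A" for x w
  proof (cases "w \<noteq> [] \<and> hd w = flip x")
    case True
    then obtain v where w: "w = flip x # v"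
      by (metis list.exhaust_sel)
    have "l x \<otimes>\<^bsub>H\<^esub> l (flip x) = \<one>\<^bsub>H\<^esub>"
      using funcset_mem[OF f that(1)] by (cases "snd x") (auto simp: l_def flip_def)
    moreover have "h v \<in> carrier H"
      using that w by (intro h) auto
    ultimately have "l x \<otimes>\<^bsub>H\<^esub> (l (flip x) \<otimes>\<^bsub>H\<^esub> h v) = h v"
      using l[of x] l[of "flip x"] that by (simp flip: H.m_assoc)
    then show ?thesis
      by (simp add: w h_def)
  qed (cases w; auto simp: h_def)
  have h_reduce: "h (reduce w) = h w" if "fst ` set w \<subseteq> A" for w
    using that
  proof (induction w)
    case (Cons x w)
    have "h (reduce (x # w)) = h (push x (reduce w))"
      by (simp add: reduce_def)
    also have "\<dots> = l x \<otimes>\<^bsub>H\<^esub> h (reduce w)"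
      using Cons.prems set_reduce[of w] by (intro h_push) auto
    finally show ?case
      using Cons by (simp add: h_def)
  qed (simp add: reduce_def)
  have h_hom: "h \<in> hom (free_group A) H"
    by (rule homI) (auto simp: free_group_def h h_reduce h_append image_Un)
  have h_gen: "h [(a, True)] = f a" if "a \<in> A" for a
    using funcset_mem[OF f that] by (simp add: h_def l_def)
  have "k w = h w" if k: "k \<in> hom (free_group A) H" "\<forall>a\<in>A. k [(a, True)] = f a"
    and w: "w \<in> carrier (free_group A)" for k w
  proof -
    interpret K: group_hom "free_group A" H k
      by unfold_locales fact
    have one: "k [] = \<one>\<^bsub>H\<^esub>"
      using K.hom_one by (simp add: free_group_def)
    have mem: "[x] \<in> carrier (free_group A)" if "fst x \<in> A" for x
      using that by (simp add: free_group_def reduced_def)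
    have letter: "k [x] = l x" if "fst x \<in> A" for x
    proof (cases "snd x")
      case False
      then have "(fst x, True) = flip x"
        by (simp add: flip_def)
      then have "[x] \<otimes>\<^bsub>free_group A\<^esub> [(fst x, True)] = \<one>\<^bsub>free_group A\<^esub>"
        by (simp add: free_group_def reduce_def)
      then have "k [x] \<otimes>\<^bsub>H\<^esub> f (fst x) = \<one>\<^bsub>H\<^esub>"
        using K.hom_mult[OF mem mem, of x "(fst x, True)"] k(2) that by simp
      then show ?thesis
        using False K.hom_closed[OF mem[OF that]] funcset_mem[OF f that]
          H.inv_equality[of "k [x]" "f (fst x)"]
        by (simp add: l_def)
    next
      case True
      then have "x = (fst x, True)"
        by (metis prod.collapse)
      then have "k [x] = f (fst x)"
        using k(2) that by metis
      then show ?thesis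
        using True by (simp add: l_def)
    qed
    show ?thesis
      using w
    proof (induction w)
      case (Cons x w)
      then have x: "fst x \<in> A" and w: "w \<in> carrier (free_group A)"
        by (auto simp: free_group_def reduced_def successively_Cons)
      have "x # w = [x] \<otimes>\<^bsub>free_group A\<^esub> w"
        using Cons.prems by (simp add: free_group_def reduce_reduced)
      then have "k (x # w) = l x \<otimes>\<^bsub>H\<^esub> h w"
        using K.hom_mult[OF mem[OF x] w] Cons.IH[OF w] letter[OF x] by simp
      then show ?case
        by (simp add: h_def)
    qed (simp add: one h_def)
  qed
  with h_hom h_gen show ?thesis
    by blast
qed


section \<open>Inner automorphisms\<close>

text \<open>Automorphisms are elements of the library's \<^const>\<open>auto\<close>, i.e. extensional functions on
  the carrier.\<close>

definition inner_autos :: "('g, 'm) monoid_scheme \<Rightarrow> ('g \<Rightarrow> 'g) set" where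
  "inner_autos G =
    (\<lambda>x. \<lambda>g\<in>carrier G. inv\<^bsub>G\<^esub> x \<otimes>\<^bsub>G\<^esub> g \<otimes>\<^bsub>G\<^esub> x) ` carrier G"


section \<open>Word metrics and visual metrics\<close>

definition finite_generating_set :: "('g, 'm) monoid_scheme \<Rightarrow> 'g set \<Rightarrow> bool" where
  "finite_generating_set G B \<longleftrightarrow>
    finite B \<and> B \<subseteq> carrier G \<and> generate G B = carrier G"

text \<open>Meaningful only if \<open>B\<close> generates \<open>G\<close>; otherwise \<open>LEAST\<close> may range over an empty set.\<close>

definition word_length :: "('g, 'm) monoid_scheme \<Rightarrow> 'g set \<Rightarrow> 'g \<Rightarrow> nat" where
  "word_length G B g =
    (LEAST n. \<exists>xs. length xs = n \<and> set xs \<subseteq> B \<union> (\<lambda>b. inv\<^bsub>G\<^esub> b) ` B \<and>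
      foldr (\<otimes>\<^bsub>G\<^esub>) xs \<one>\<^bsub>G\<^esub> = g)"

definition word_dist :: "('g, 'm) monoid_scheme \<Rightarrow> 'g set \<Rightarrow> 'g \<Rightarrow> 'g \<Rightarrow> real" where
  "word_dist G B g h = real (word_length G B (inv\<^bsub>G\<^esub> g \<otimes>\<^bsub>G\<^esub> h))"

definition gromov_product ::
    "('g, 'm) monoid_scheme \<Rightarrow> 'g set \<Rightarrow> 'g \<Rightarrow> 'g \<Rightarrow> 'g \<Rightarrow> real" where
  "gromov_product G B p g h =
    (word_dist G B p g + word_dist G B p h - word_dist G B g h) / 2"

definition visual_rho ::
    "('g, 'm) monoid_scheme \<Rightarrow> 'g set \<Rightarrow> 'g \<Rightarrow> real \<Rightarrow> 'g \<Rightarrow> 'g \<Rightarrow> real" where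
  "visual_rho G B p \<gamma> g h =
    (if g = h then 0 else exp (- \<gamma> * gromov_product G B p g h))"

definition visual_metrics ::
    "('g, 'm) monoid_scheme \<Rightarrow> 'g set \<Rightarrow> 'g \<Rightarrow> real \<Rightarrow> real \<Rightarrow> ('g \<Rightarrow> 'g \<Rightarrow> real) set" where
  "visual_metrics G B p \<gamma> T =
    {d. Metric_space (carrier G) d \<and>
      (\<forall>g\<in>carrier G. \<forall>h\<in>carrier G. g \<noteq> h \<longrightarrow>
        1 / T * visual_rho G B p \<gamma> g h \<le> d g h \<and> d g h \<le> T * visual_rho G B p \<gamma> g h)}"

definition visual_metric :: "('g, 'm) monoid_scheme \<Rightarrow> ('g \<Rightarrow> 'g \<Rightarrow> real) \<Rightarrow> bool" where
  "visual_metric G d \<longleftrightarrow>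
    (\<exists>B p \<gamma> T. finite_generating_set G B \<and> p \<in> carrier G \<and> \<gamma> > 0 \<and> T \<ge> 1 \<and>
      d \<in> visual_metrics G B p \<gamma> T)"

definition satisfies_Lipschitz :: "'g set \<Rightarrow> ('g \<Rightarrow> 'g \<Rightarrow> real) \<Rightarrow> ('g \<Rightarrow> 'g) \<Rightarrow> bool" where
  "satisfies_Lipschitz M d \<phi> \<longleftrightarrow>
    (\<exists>K>0. \<forall>g\<in>M. \<forall>h\<in>M. d (\<phi> g) (\<phi> h) \<le> K * d g h)"

end

theory Submission
  imports Defs "HOL-Library.Sublist"
begin

text \<open>
  For a visual metric with respect to a finite generating set \<open>B\<close>, comparing neighbours \<open>g\<close> and \<open>g x\<close>
  shows that a Lipschitz automorphism \<open>\<phi>\<close> satisfies \<open>|g|\<^sub>B \<le> |\<phi> g|\<^sub>B + C\<close>. Visual metrics exist for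
  every \<open>B\<close>: the length \<open>|\<cdot>|\<^sub>B\<close> is almost additive on reduced concatenations, so the Gromov product
  of two words is, up to a constant, the length of their longest common prefix, and making this
  length monotone along prefixes gives an ultrametric.

  Let \<open>u\<close> be cyclically reduced and suppose that for some \<open>k\<close> neither \<open>u\<^sup>k\<close> nor \<open>u\<^sup>-\<^sup>k\<close> occurs in any power
  of \<open>\<phi> u\<close>. Adjoining a high power of \<open>\<phi> u\<close> to the basis then shortens the powers of \<open>\<phi> u\<close> more than
  those of \<open>u\<close>, contradicting the inequality. So the powers of \<open>u\<close> or of its inverse occur in powers
  of \<open>\<phi> u\<close>, that is, the two have the same periodic word up to conjugation. For \<open>u = a\<close>, \<open>u = ab\<close> and
  \<open>u = aababb\<close> this forces \<open>\<phi>\<close> to be conjugation by a fixed element. Conversely, inner automorphisms,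
  and all automorphisms in rank at most one, change word distances by a bounded amount.
\<close>

section \<open>Words\<close>

definition winv :: "'a letter list \<Rightarrow> 'a letter list" where
  "winv w = rev (map flip w)"

definition wpow :: "nat \<Rightarrow> 'a list \<Rightarrow> 'a list" where
  "wpow n w = concat (replicate n w)"

lemma winv_simps [simp]:
  "winv [] = []" "winv [x] = [flip x]" "winv (u @ v) = winv v @ winv u" "winv (winv w) = w"
  "length (winv w) = length w" "winv w = [] \<longleftrightarrow> w = []" "set (winv w) = flip ` set w"
  by (simp_all add: winv_def rev_map comp_def)

lemma winv_Cons: "winv (x # w) = winv w @ [flip x]"
  by (simp add: winv_def)

lemma last_winv: "w \<noteq> [] \<Longrightarrow> last (winv w) = flip (hd w)"
  by (cases w) (simp_all add: winv_Cons)

lemma fst_image_winv [simp]: "fst ` flip ` S = fst ` S"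
  by (simp add: image_image)

lemma flip_neq [simp]: "flip x \<noteq> x" "x \<noteq> flip x"
  by (auto simp: flip_def prod_eq_iff)

lemma flip_eq_iff: "flip x = y \<longleftrightarrow> x = flip y"
  by auto

lemma flip_Pair [simp]: "flip (a, b) = (a, \<not> b)"
  by (simp add: flip_def)

lemma reduced_append_iff:
  "reduced (u @ v) \<longleftrightarrow> reduced u \<and> reduced v \<and> (u = [] \<or> v = [] \<or> hd v \<noteq> flip (last u))"
  by (simp add: reduced_def successively_append_iff)

lemma reduced_appendD: "reduced (u @ v) \<Longrightarrow> reduced u" "reduced (u @ v) \<Longrightarrow> reduced v"
  by (simp_all add: reduced_append_iff)

lemma reduced_singleton [simp]: "reduced [x]"
  by (simp add: reduced_def)

lemma reduced_Cons: "reduced (x # w) \<longleftrightarrow> reduced w \<and> (w = [] \<or> hd w \<noteq> flip x)"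
  using reduced_append_iff[of "[x]" w] by simp

lemma reduced_winv [simp]: "reduced (winv w) \<longleftrightarrow> reduced w"
  using reduced_inverse[of w] reduced_inverse[of "winv w"] by (auto simp flip: winv_def)

lemma reduce_Nil [simp]: "reduce [] = []"
  by (simp add: reduce_def)

lemma reduce_winv_append [simp]: "reduce (winv w @ w) = []"
  by (simp add: winv_def reduce_inverse)

lemma reduce_append_winv [simp]: "reduce (w @ winv w) = []"
  using reduce_inverse[of "winv w"] by (simp flip: winv_def)

lemma reduce_cong_append:
  assumes "reduce u = reduce u'" "reduce v = reduce v'"
  shows "reduce (u @ v) = reduce (u' @ v')"
proof -
  have "reduce (u @ v) = reduce (reduce u @ reduce v)"
    by (simp only: reduce_append_left reduce_append_right)
  also have "\<dots> = reduce (u' @ v')"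
    by (simp only: assms reduce_append_left reduce_append_right)
  finally show ?thesis .
qed

lemma reduce_cancel_mid:
  assumes "reduce m = []"
  shows "reduce (u @ m @ v) = reduce (u @ v)"
proof (rule reduce_cong_append[OF refl])
  show "reduce (m @ v) = reduce v"
    using reduce_append_left[of m v] by (simp add: assms)
qed

lemma reduce_idem [simp]: "reduce (reduce w) = reduce w"
  by (simp add: reduce_reduced reduced_reduce)

lemma reduce_winv: "reduce (winv w) = winv (reduce w)"
proof -
  have "reduce (winv w) = reduce (winv w @ reduce w @ winv (reduce w))"
    using reduce_cancel_mid[of "reduce w @ winv (reduce w)" "winv w" "[]"] by simp
  also have "\<dots> = reduce ((winv w @ w) @ winv (reduce w))"
    by (metis append.assoc reduce_append_left reduce_append_right)
  also have "\<dots> = reduce (winv (reduce w))"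
    by (metis append_Nil reduce_append_left reduce_winv_append)
  finally show ?thesis by (simp add: reduce_reduced reduced_reduce)
qed

lemma wpow_simps [simp]: "wpow 0 w = []" "wpow (Suc n) w = w @ wpow n w" "wpow n [] = []"
  by (simp_all add: wpow_def concat_replicate_trivial)

lemma wpow_add: "wpow (m + n) w = wpow m w @ wpow n w"
  by (induction m) auto

lemma wpow_mult: "wpow (m * n) w = wpow m (wpow n w)"
  by (induction m) (auto simp: wpow_add)

lemma wpow_Suc_right: "wpow (Suc n) w = wpow n w @ w"
  using wpow_add[of n 1 w] by simp

lemma length_wpow [simp]: "length (wpow n w) = n * length w"
  by (induction n) auto

lemma winv_wpow: "winv (wpow n w) = wpow n (winv w)"
proof (induction n)
  case (Suc n)
  then show ?case
    using wpow_Suc_right[of n "winv w"] by simp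
qed simp

lemma nth_wpow: "i < n * length w \<Longrightarrow> wpow n w ! i = w ! (i mod length w)"
proof (induction n arbitrary: i)
  case (Suc n)
  then show ?case
    by (cases "i < length w") (auto simp: nth_append le_mod_geq)
qed simp

lemma reduce_wpow_reduce: "reduce (wpow n (reduce w)) = reduce (wpow n w)"
proof (induction n)
  case (Suc n)
  then show ?case
    using reduce_cong_append[OF reduce_idem[of w] Suc] by simp
qed simp

definition cyc_reduced :: "'a letter list \<Rightarrow> bool" where
  "cyc_reduced w \<longleftrightarrow> reduced (w @ w)"

lemma cyc_reduced_imp_reduced: "cyc_reduced w \<Longrightarrow> reduced w"
  by (simp add: cyc_reduced_def reduced_append_iff)

lemma reduced_wpow: "cyc_reduced w \<Longrightarrow> reduced (wpow n w)"
proof (induction n)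
  case (Suc n)
  then show ?case
    by (cases n) (auto simp: cyc_reduced_def reduced_append_iff)
qed simp

lemma reduce_append_cancellation:
  assumes "reduced u" "reduced v"
  shows "\<exists>u' t v'. u = u' @ t \<and> v = winv t @ v' \<and> reduce (u @ v) = u' @ v'"
  using assms
proof (induction u)
  case Nil
  then show ?case by (simp add: reduce_reduced)
next
  case (Cons x u)
  then obtain u' t v' where *: "u = u' @ t" "v = winv t @ v'" "reduce (u @ v) = u' @ v'"
    by (auto simp: reduced_Cons)
  have eq: "reduce ((x # u) @ v) = push x (u' @ v')"
    by (simp add: reduce_def flip: *(3))
  show ?case
  proof (cases "u' = [] \<and> v' \<noteq> [] \<and> hd v' = flip x")
    case True
    then obtain v'' where "v' = flip x # v''"
      by (metis list.exhaust_sel)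
    then show ?thesis
      using True * eq
      by (intro exI[of _ "[]"] exI[of _ "x # t"] exI[of _ v'']) (auto simp: winv_Cons)
  next
    case False
    have "push x (u' @ v') = x # u' @ v'"
    proof (cases u')
      case Nil
      then show ?thesis using False by (cases v') auto
    next
      case (Cons y ys)
      then show ?thesis using Cons.prems * by (auto simp: reduced_Cons)
    qed
    then show ?thesis
      using * eq
      by (intro exI[of _ "x # u'"] exI[of _ t] exI[of _ v']) auto
  qed
qed

lemma reduce_append_drop_left:
  assumes "reduced z" "reduced (p @ m)" "length z \<le> length p"
  shows "\<exists>p'. reduce (z @ p @ m) = p' @ m"
proof -
  obtain z' t w where *: "z = z' @ t" "p @ m = winv t @ w" "reduce (z @ p @ m) = z' @ w"
    using reduce_append_cancellation[OF assms(1,2)] by blast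
  then have "length (winv t) \<le> length p"
    using assms(3) by simp
  with *(2) have "w = drop (length (winv t)) p @ m"
    by (metis append_eq_append_conv_if)
  with *(3) show ?thesis by simp
qed

lemma reduce_append_drop_right:
  assumes "reduced y" "reduced (m @ q)" "length y \<le> length q"
  shows "\<exists>q'. reduce (m @ q @ y) = m @ q'"
proof -
  have "\<exists>p'. reduce (winv y @ winv q @ winv m) = p' @ winv m"
    using assms reduced_winv[of "m @ q"] by (intro reduce_append_drop_left) simp_all
  then obtain p' where "winv (reduce (winv y @ winv q @ winv m)) = winv (p' @ winv m)"
    by metis
  then have "reduce (m @ q @ y) = m @ winv p'"
    by (simp flip: reduce_winv)
  then show ?thesis by blast
qed

lemma reduced_decomp:
  assumes "reduced v" "v \<noteq> []"
  shows "\<exists>z w. v = z @ w @ winv z \<and> w \<noteq> [] \<and> cyc_reduced w"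
  using assms
proof (induction "length v" arbitrary: v rule: less_induct)
  case less
  show ?case
  proof (cases "hd v = flip (last v)")
    case False
    then show ?thesis
      using less.prems
      by (intro exI[of _ "[]"] exI[of _ v]) (auto simp: cyc_reduced_def reduced_append_iff)
  next
    case True
    obtain x w where v: "v = x # w"
      using less.prems by (cases v) auto
    have "w \<noteq> []"
      using True v by auto
    then obtain w' where w: "w = w' @ [flip x]"
      using True v by (metis append_butlast_last_id flip_eq_iff last_ConsR list.sel(1))
    have "w' \<noteq> []" "reduced w'"
      using less.prems v w by (auto simp: reduced_Cons reduced_append_iff)
    then obtain z y where "w' = z @ y @ winv z" "y \<noteq> []" "cyc_reduced y"
      using less.hyps[of w'] v w by auto
    then show ?thesis
      using v w by (intro exI[of _ "x # z"] exI[of _ y]) (simp add: winv_Cons)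
  qed
qed

lemma reduce_commute:
  assumes "fst ` set (u @ v) \<subseteq> {a}"
  shows "reduce (u @ v) = reduce (v @ u)"
proof -
  have letter: "reduce (x # w) = reduce (w @ [x])" if "fst ` set (x # w) \<subseteq> {a}" for x w
    using that
  proof (induction w)
    case (Cons y w)
    have "reduce [x, y] = reduce [y, x]"
      using Cons.prems by (cases x; cases y) (auto simp: reduce_def)
    then have "reduce (x # y # w) = reduce (y # x # w)"
      using reduce_cong_append[of "[x, y]" "[y, x]" w w] by simp
    also have "\<dots> = reduce (y # w @ [x])"
      using Cons reduce_cong_append[of "[y]" "[y]" "x # w" "w @ [x]"] by simp
    finally show ?case by simp
  qed simp
  show ?thesis
    using assms
  proof (induction u arbitrary: v)
    case (Cons x u)
    have "reduce (x # u @ v) = reduce (u @ v @ [x])"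
      using letter[of x "u @ v"] Cons.prems by simp
    also have "\<dots> = reduce (v @ x # u)"
      using Cons.IH[of "v @ [x]"] Cons.prems by simp
    finally show ?case by simp
  qed simp
qed

section \<open>Powers contained in powers\<close>

definition powers_occur :: "'a letter list \<Rightarrow> 'a letter list \<Rightarrow> bool" where
  "powers_occur u v \<longleftrightarrow> (\<forall>k. \<exists>n. sublist (wpow k u) (reduce (wpow n v)) \<or>
     sublist (wpow k (winv u)) (reduce (wpow n v)))"

lemma reduce_wpow_conj: "reduce (wpow n (z @ v @ winv z)) = reduce (z @ wpow n v @ winv z)"
proof (induction n)
  case (Suc n)
  have "reduce (wpow (Suc n) (z @ v @ winv z)) = reduce ((z @ v @ winv z) @ z @ wpow n v @ winv z)"
    using reduce_cong_append[OF refl Suc, of "z @ v @ winv z"] by simp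
  also have "\<dots> = reduce (z @ wpow (Suc n) v @ winv z)"
    using reduce_cancel_mid[of "winv z @ z" "z @ v" "wpow n v @ winv z"] by simp
  finally show ?case .
qed simp

lemma sublist_reduce_conj:
  assumes "reduced z" "reduced w" "s \<noteq> []" "sublist (wpow (k + 2 * length z) s) w"
  shows "sublist (wpow k s) (reduce (z @ w @ winv z))"
proof -
  let ?p = "wpow (length z) s"
  have "wpow (k + 2 * length z) s = ?p @ wpow k s @ ?p"
    by (metis add.commute add.left_commute mult_2 wpow_add)
  then obtain x y where w: "w = (x @ ?p) @ wpow k s @ ?p @ y"
    using assms(4) by (auto simp: sublist_def)
  have "length z \<le> length ?p"
    using assms(3) by (cases s) auto
  then have len: "length z \<le> length (x @ ?p)" "length (winv z) \<le> length (?p @ y)"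
    by (simp_all del: length_wpow)
  obtain p where p: "reduce (z @ w) = p @ wpow k s @ ?p @ y"
    using reduce_append_drop_left[OF assms(1) assms(2)[unfolded w] len(1)] w by auto
  have "reduced ((p @ wpow k s) @ ?p @ y)"
    using reduced_reduce[of "z @ w"] p by simp
  then obtain q where "reduce ((p @ wpow k s) @ (?p @ y) @ winv z) = (p @ wpow k s) @ q"
    using reduce_append_drop_right[of "winv z" "p @ wpow k s" "?p @ y"] assms(1) len(2) by auto
  moreover have "reduce (z @ w @ winv z) = reduce (reduce (z @ w) @ winv z)"
    by (simp only: reduce_append_left append_assoc)
  ultimately show ?thesis
    using p by simp
qed

lemma powers_occur_conj:
  assumes "powers_occur u v" "reduced z" "u \<noteq> []"
  shows "powers_occur u (reduce (z @ v @ winv z))"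
  unfolding powers_occur_def
proof
  fix k
  obtain n where n: "sublist (wpow (k + 2 * length z) u) (reduce (wpow n v)) \<or>
      sublist (wpow (k + 2 * length z) (winv u)) (reduce (wpow n v))"
    using assms(1) unfolding powers_occur_def by blast
  have "reduce (wpow n (reduce (z @ v @ winv z))) = reduce (z @ reduce (wpow n v) @ winv z)"
    unfolding reduce_wpow_reduce reduce_wpow_conj
    by (intro reduce_cong_append refl) simp
  with n show "\<exists>n. sublist (wpow k u) (reduce (wpow n (reduce (z @ v @ winv z)))) \<or>
      sublist (wpow k (winv u)) (reduce (wpow n (reduce (z @ v @ winv z))))"
    using sublist_reduce_conj[OF assms(2) reduced_reduce, of _ k] assms(3)
    by (metis winv_simps(6))
qed

definition same_period :: "'a list \<Rightarrow> 'a list \<Rightarrow> bool" where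
  "same_period u v \<longleftrightarrow> (\<exists>c. \<forall>i. u ! (i mod length u) = v ! ((i + c) mod length v))"

lemma same_periodI:
  assumes "u \<noteq> []" "v \<noteq> []" "sublist (wpow (length v) u) (wpow n v)"
  shows "same_period u v"
proof -
  obtain x y where xy: "wpow n v = x @ wpow (length v) u @ y"
    using assms(3) by (auto simp: sublist_def)
  let ?m = "length v * length u"
  have "u ! (i mod length u) = v ! ((i + length x) mod length v)" for i
  proof -
    have "?m > 0"
      using assms by simp
    then have i: "i mod ?m < ?m"
      by simp
    have "length (wpow n v) = length x + ?m + length y"
      using xy by simp
    then have le: "length x + i mod ?m < n * length v"
      using i by simp
    have "u ! (i mod ?m mod length u) = wpow n v ! (length x + i mod ?m)"
      using i xy by (simp add: nth_append nth_wpow)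
    also have "\<dots> = v ! ((length x + i mod ?m) mod length v)"
      using nth_wpow[OF le] .
    also have "(length x + i mod ?m) mod length v = (length x + i) mod length v"
      by (metis dvd_triv_left mod_add_right_eq mod_mod_cancel)
    finally show ?thesis
      by (simp add: mod_mod_cancel add.commute)
  qed
  then show ?thesis
    unfolding same_period_def by blast
qed

lemma powers_occur_same_period:
  assumes "powers_occur u v" "u \<noteq> []" "v \<noteq> []" "cyc_reduced v"
  shows "same_period u v \<or> same_period (winv u) v"
proof -
  obtain n where "sublist (wpow (length v) u) (wpow n v) \<or>
      sublist (wpow (length v) (winv u)) (wpow n v)"
    using assms(1) reduce_reduced[OF reduced_wpow[OF assms(4)]]
    unfolding powers_occur_def by metis
  then show ?thesis
    using assms(2,3) same_periodI by (metis winv_simps(6))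
qed

lemma same_period_nth:
  assumes "same_period u v" "j < length v"
  shows "\<exists>i. u ! (i mod length u) = v ! j \<and>
    u ! (Suc i mod length u) = v ! (Suc j mod length v)"
proof -
  obtain c where c: "\<And>i. u ! (i mod length u) = v ! ((i + c) mod length v)"
    using assms(1) unfolding same_period_def by blast
  define i where "i = j + c * (length v - 1)"
  have "i + c = j + c * length v"
    using assms(2) unfolding i_def by (cases "length v") auto
  then have "(i + c) mod length v = j" "(Suc i + c) mod length v = Suc j mod length v"
    using assms(2) by auto
  with c[of i] c[of "Suc i"] show ?thesis
    by metis
qed

lemma same_period_subset:
  assumes "same_period u v" "u \<noteq> []"
  shows "set v \<subseteq> set u"
proof
  fix x assume "x \<in> set v"
  then obtain j where "j < length v" "v ! j = x"
    by (auto simp: in_set_conv_nth)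
  then obtain i where "u ! (i mod length u) = x"
    using same_period_nth[OF assms(1)] by blast
  then show "x \<in> set u"
    using assms(2) by (metis length_greater_0_conv mod_less_divisor nth_mem)
qed

lemma same_period_alternating:
  assumes "same_period [x, y] v" "x \<noteq> y" "v = p @ [a, b] @ q"
  shows "a \<noteq> b"
proof
  assume "a = b"
  have "length p < length v" "Suc (length p) mod length v = Suc (length p)"
    using assms(3) by simp_all
  then obtain i where "[x, y] ! (i mod 2) = v ! length p" "[x, y] ! (Suc i mod 2) = v ! Suc (length p)"
    using same_period_nth[OF assms(1)] by (metis length_Cons list.size(3) numeral_2_eq_2)
  then have "[x, y] ! (i mod 2) = [x, y] ! (Suc i mod 2)"
    using assms(3) \<open>a = b\<close> by (simp add: nth_append)
  moreover have "i mod 2 = 0 \<and> Suc i mod 2 = 1 \<or> i mod 2 = 1 \<and> Suc i mod 2 = 0"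
    by presburger
  ultimately show False
    using assms(2) by auto
qed

lemma powers_occur_letter:
  assumes "powers_occur [(a, True)] v" "reduced v"
  shows "\<exists>z n s. v = z @ replicate (Suc n) (a, s) @ winv z"
proof -
  have "v \<noteq> []"
  proof
    assume "v = []"
    then show False
      using assms(1) unfolding powers_occur_def by (auto dest!: spec[of _ 1])
  qed
  then obtain z w where v: "v = z @ w @ winv z" and w: "w \<noteq> []" "cyc_reduced w"
    using reduced_decomp[OF assms(2)] by blast
  have "reduced z"
    using assms(2) v by (simp add: reduced_append_iff)
  have "reduce (winv z @ v @ z) = reduce (winv z @ z @ w)"
    using reduce_cancel_mid[of "winv z @ z" "winv z @ z @ w" "[]"] v by simp
  also have "\<dots> = w"
    using reduce_cancel_mid[of "winv z @ z" "[]" w] reduce_reduced[OF cyc_reduced_imp_reduced[OF w(2)]]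
    by simp
  finally have "powers_occur [(a, True)] w"
    using powers_occur_conj[OF assms(1), of "winv z"] \<open>reduced z\<close> by simp
  then have "same_period [(a, True)] w \<or> same_period [(a, False)] w"
    using powers_occur_same_period[of "[(a, True)]" w] w by simp
  then obtain s where "set w \<subseteq> {(a, s)}"
    using same_period_subset[of "[(a, _)]" w] by fastforce
  then have "w = replicate (Suc (length w - 1)) (a, s)"
    using w(1) by (metis Suc_pred' length_greater_0_conv replicate_eqI singletonD subsetD)
  with v show ?thesis by metis
qed

lemma powers_occur_two_letters:
  assumes "a \<noteq> b" and v: "reduced v" "v = y @ replicate (Suc n) (b, s) @ winv y"
    and occur: "powers_occur [(a, True), (b, True)] (reduce (replicate (Suc l) (a, r) @ v))"
  shows "l = 0 \<and> n = 0 \<and> s = r \<and> fst ` set y \<subseteq> {a}"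
proof -
  define p where "p = takeWhile (\<lambda>x. fst x = a) y"
  define q where "q = dropWhile (\<lambda>x. fst x = a) y"
  define L where "L = replicate (Suc l) (a, r)"
  define N where "N = replicate (Suc n) (b, s)"
  define w where "w = L @ q @ N @ winv q"
  have y: "y = p @ q"
    by (simp add: p_def q_def)
  have p: "fst ` set p \<subseteq> {a}"
    by (auto simp: p_def dest: set_takeWhileD)
  have q: "fst (hd q) \<noteq> a" if "q \<noteq> []"
    using that hd_dropWhile[of "\<lambda>x. fst x = a" y] unfolding q_def by simp
  have "reduced (p @ (q @ N @ winv q) @ winv p)"
    using v y by (simp add: N_def)
  then have red: "reduced p" "reduced (q @ N @ winv q)"
    by (blast dest: reduced_appendD)+
  have L: "reduced L" "L \<noteq> []" "hd L = (a, r)" "last L = (a, r)"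
    by (auto simp: L_def reduced_def successively_conv_nth nth_Cons split: nat.split)
  have N: "N \<noteq> []" "hd N = (b, s)"
    by (auto simp: N_def)
  have cyc: "cyc_reduced w"
  proof -
    have "hd (q @ N @ winv q) \<noteq> flip (last L)"
      using q assms(1) L N by (cases q) auto
    then have 1: "reduced w"
      using L red by (auto simp: w_def reduced_append_iff[of L])
    have "last w = (if q = [] then last N else flip (hd q))"
      using N by (cases q) (auto simp: w_def winv_Cons)
    moreover have "fst (last N) = b"
      by (simp add: N_def)
    ultimately have "fst (last w) \<noteq> a"
      using q assms(1) by (auto split: if_splits)
    moreover have "hd w = (a, r)"
      using L by (simp add: w_def)
    ultimately have "hd w \<noteq> flip (last w)"
      by (metis fst_conv fst_flip)
    with 1 show ?thesis
      by (auto simp: cyc_reduced_def reduced_append_iff[of w w])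
  qed
  have "reduce (winv p @ reduce (L @ v) @ winv (winv p)) = reduce ((winv p @ L) @ v @ p)"
    using reduce_cong_append[OF refl reduce_append_left[of "L @ v" p], of "winv p"] by simp
  also have "\<dots> = reduce ((L @ winv p) @ v @ p)"
    using p by (intro reduce_cong_append refl reduce_commute[of _ _ a])
      (auto simp: L_def)
  also have "\<dots> = reduce ((L @ winv p @ p @ q @ N @ winv q) @ winv p @ p)"
    using v by (simp add: y N_def)
  also have "\<dots> = reduce w"
    using reduce_cancel_mid[of "winv p @ p" "L @ winv p @ p @ q @ N @ winv q" "[]"]
      reduce_cancel_mid[of "winv p @ p" L "q @ N @ winv q"] by (simp add: w_def)
  also have "\<dots> = w"
    using cyc by (simp add: reduce_reduced cyc_reduced_imp_reduced)
  finally have "powers_occur [(a, True), (b, True)] w"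
    using powers_occur_conj[OF occur, of "winv p"] red by (simp add: L_def)
  then have "same_period [(a, True), (b, True)] w \<or> same_period [(b, False), (a, False)] w"
    using powers_occur_same_period[of "[(a, True), (b, True)]" w] cyc L
    by (simp add: w_def winv_Cons)
  then obtain x1 x2 t where per: "same_period [x1, x2] w" and x: "{x1, x2} = {(a, t), (b, t)}"
    by blast
  have sub: "set w \<subseteq> {(a, t), (b, t)}"
    using same_period_subset[OF per] x by simp
  have "x1 \<noteq> x2"
    using x assms(1) by (auto simp: doubleton_eq_iff)
  note alt = same_period_alternating[OF per this]
  have "q = []"
  proof (rule ccontr)
    assume "q \<noteq> []"
    then have "hd q \<in> set w" "flip (hd q) \<in> set w"
      by (auto simp: w_def)
    then have "snd (hd q) = t" "snd (flip (hd q)) = t"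
      using sub by auto
    then show False
      by (simp add: flip_def)
  qed
  moreover have "r = t" "s = t"
    using sub assms(1) by (auto simp: w_def L_def N_def)
  moreover have "l = 0"
  proof (rule ccontr)
    assume "l \<noteq> 0"
    then have "w = [] @ [(a, r), (a, r)] @ replicate (l - 1) (a, r) @ q @ N @ winv q"
      by (cases l) (auto simp: w_def L_def)
    then show False
      using alt by blast
  qed
  moreover have "n = 0"
  proof (rule ccontr)
    assume "n \<noteq> 0"
    then have "w = (L @ q) @ [(b, s), (b, s)] @ replicate (n - 1) (b, s) @ winv q"
      by (cases n) (auto simp: w_def N_def)
    then show False
      using alt by blast
  qed
  ultimately show ?thesis
    using p y by simp
qed

text \<open>The inverse of \<open>u\<close> is the reversal of \<open>map flip u\<close>, and \<open>aababb\<close> differs from its reversal even as a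
  cyclic word.\<close>

lemma powers_occur_not_flip:
  assumes "a \<noteq> b"
    and "u = [(a, True), (a, True), (b, True), (a, True), (b, True), (b, True)]"
  shows "\<not> powers_occur u (map flip u)"
proof
  assume occur: "powers_occur u (map flip u)"
  have "cyc_reduced (map flip u)"
    by (simp add: assms(2) cyc_reduced_def reduced_def)
  then have "same_period u (map flip u) \<or> same_period (winv u) (map flip u)"
    using powers_occur_same_period[OF occur] assms(2) by simp
  then show False
  proof
    assume "same_period u (map flip u)"
    then show False
      using same_period_subset[of u "map flip u"] assms by auto
  next
    assume "same_period (winv u) (map flip u)"
    then obtain c where c: "\<And>i. winv u ! (i mod 6) = map flip u ! ((i + c) mod 6)"
      unfolding same_period_def using assms(2) by auto
    define e where "e = c mod 6"
    have *: "winv u ! (i mod 6) = map flip u ! ((i + e) mod 6)" for i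
      using c[of i] by (simp add: e_def mod_add_right_eq)
    have "e < 6"
      by (simp add: e_def)
    then consider "e = 0" | "e = 1" | "e = 2" | "e = 3" | "e = 4" | "e = 5"
      by linarith
    then show False
      using *[of 0] *[of 1] *[of 2] *[of 3] *[of 4] *[of 5] assms
      by cases (auto simp: winv_Cons)
  qed
qed

section \<open>Word metrics\<close>

locale word_metric = group G for G :: "('g, 'm) monoid_scheme" (structure) +
  fixes B :: "'g set"
  assumes generating: "finite_generating_set G B"
begin

abbreviation "gens \<equiv> B \<union> (\<lambda>b. inv b) ` B"
abbreviation "product xs \<equiv> foldr (\<otimes>) xs \<one>"
abbreviation "len \<equiv> word_length G B"

lemma gens_closed: "gens \<subseteq> carrier G"
  using generating by (auto simp: finite_generating_set_def)

lemma finite_gens: "finite gens"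
  using generating by (simp add: finite_generating_set_def)

lemma inv_gens: "x \<in> gens \<Longrightarrow> inv x \<in> gens"
  using generating by (auto simp: finite_generating_set_def)

lemma product_closed [simp]: "set xs \<subseteq> carrier G \<Longrightarrow> product xs \<in> carrier G"
  by (induction xs) auto

lemma product_append:
  "set xs \<subseteq> carrier G \<Longrightarrow> set ys \<subseteq> carrier G \<Longrightarrow>
    product (xs @ ys) = product xs \<otimes> product ys"
  by (induction xs) (auto simp: m_assoc)

lemma product_inv:
  "set xs \<subseteq> carrier G \<Longrightarrow> product (rev (map (\<lambda>x. inv x) xs)) = inv (product xs)"
proof (induction xs)
  case (Cons x xs)
  then have "set (rev (map (\<lambda>x. inv x) xs)) \<subseteq> carrier G"
    by auto
  then show ?case
    using Cons product_append[of "rev (map (\<lambda>x. inv x) xs)" "[inv x]"]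
    by (simp add: inv_mult_group del: foldr_append)
qed simp

lemma ex_product:
  assumes "g \<in> carrier G"
  shows "\<exists>xs. set xs \<subseteq> gens \<and> product xs = g"
proof -
  have "g \<in> generate G B"
    using assms generating by (simp add: finite_generating_set_def)
  then show ?thesis
  proof induction
    case one
    then show ?case by (intro exI[of _ "[]"]) simp
  next
    case (incl h)
    then show ?case using gens_closed by (intro exI[of _ "[h]"]) auto
  next
    case (inv h)
    then show ?case using gens_closed by (intro exI[of _ "[inv h]"]) auto
  next
    case (eng h1 h2)
    then obtain xs ys where "set xs \<subseteq> gens" "product xs = h1" "set ys \<subseteq> gens" "product ys = h2"
      by blast
    then show ?case
      using product_append[of xs ys] gens_closed by (intro exI[of _ "xs @ ys"]) auto
  qed
qed

lemma len_product_le: "set xs \<subseteq> gens \<Longrightarrow> len (product xs) \<le> length xs"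
  unfolding word_length_def by (intro Least_le exI[of _ xs]) simp

lemma ex_geodesic:
  assumes "g \<in> carrier G"
  shows "\<exists>xs. set xs \<subseteq> gens \<and> product xs = g \<and> length xs = len g"
proof -
  have "\<exists>n xs. length xs = n \<and> set xs \<subseteq> gens \<and> product xs = g"
    using ex_product[OF assms] by blast
  from LeastI_ex[OF this] show ?thesis
    unfolding word_length_def by blast
qed

lemma len_one [simp]: "len \<one> = 0"
  using len_product_le[of "[]"] by simp

lemma len_gens: "x \<in> gens \<Longrightarrow> len x \<le> 1"
  using len_product_le[of "[x]"] gens_closed by (auto simp del: UnE)

lemma len_mult:
  assumes "g \<in> carrier G" "h \<in> carrier G"
  shows "len (g \<otimes> h) \<le> len g + len h"
proof -
  obtain xs where xs: "set xs \<subseteq> gens" "product xs = g" "length xs = len g"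
    using ex_geodesic[OF assms(1)] by blast
  obtain ys where ys: "set ys \<subseteq> gens" "product ys = h" "length ys = len h"
    using ex_geodesic[OF assms(2)] by blast
  note * = xs ys
  then have "product (xs @ ys) = g \<otimes> h"
    using gens_closed product_append[of xs ys] by blast
  then show ?thesis
    using * len_product_le[of "xs @ ys"] by simp
qed

lemma len_inv [simp]:
  assumes "g \<in> carrier G"
  shows "len (inv g) = len g"
proof -
  have le: "len (inv h) \<le> len h" if h: "h \<in> carrier G" for h
  proof -
    obtain xs where xs: "set xs \<subseteq> gens" "product xs = h" "length xs = len h"
      using ex_geodesic[OF h] by blast
    then have "set (rev (map (\<lambda>x. inv x) xs)) \<subseteq> gens"
      using inv_gens by auto
    from len_product_le[OF this] show ?thesis
      using xs product_inv[OF order_trans[OF xs(1) gens_closed]] by (simp only: length_rev length_map)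
  qed
  from le[OF assms] le[of "inv g"] assms show ?thesis
    by simp
qed

lemma len_pow: "g \<in> carrier G \<Longrightarrow> len (g [^] (n::nat)) \<le> n * len g"
proof (induction n)
  case (Suc n)
  then show ?case
    using len_mult[of "g [^] n" g] by simp
qed simp

lemma word_dist_mult_left:
  assumes "x \<in> carrier G" "g \<in> carrier G" "h \<in> carrier G"
  shows "word_dist G B (x \<otimes> g) (x \<otimes> h) = word_dist G B g h"
proof -
  have "inv (x \<otimes> g) \<otimes> (x \<otimes> h) = inv g \<otimes> h"
    using assms by (simp add: inv_mult_group m_assoc) (simp flip: m_assoc)
  then show ?thesis
    by (simp add: word_dist_def)
qed

lemma word_dist_triangle:
  assumes "x \<in> carrier G" "y \<in> carrier G" "z \<in> carrier G"
  shows "word_dist G B x z \<le> word_dist G B x y + word_dist G B y z"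
proof -
  have "inv x \<otimes> z = (inv x \<otimes> y) \<otimes> (inv y \<otimes> z)"
    using assms by (simp add: m_assoc) (simp flip: m_assoc)
  then show ?thesis
    unfolding word_dist_def using assms len_mult[of "inv x \<otimes> y" "inv y \<otimes> z"] by simp
qed

lemma word_dist_commute:
  assumes "x \<in> carrier G" "y \<in> carrier G"
  shows "word_dist G B x y = word_dist G B y x"
proof -
  have "inv x \<otimes> y = inv (inv y \<otimes> x)"
    using assms by (simp add: inv_mult_group)
  then show ?thesis
    unfolding word_dist_def using assms len_inv[of "inv y \<otimes> x"] by simp
qed

lemma word_dist_one: "g \<in> carrier G \<Longrightarrow> word_dist G B \<one> g = len g"
  by (simp add: word_dist_def)

lemma Lipschitz_if_quasi_isometric:
  assumes d: "d \<in> visual_metrics G B p \<gamma> T" and p: "p \<in> carrier G" and pos: "\<gamma> > 0" "T \<ge> 1"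
    and closed: "\<And>g. g \<in> carrier G \<Longrightarrow> \<phi> g \<in> carrier G"
    and dist: "\<And>g h. g \<in> carrier G \<Longrightarrow> h \<in> carrier G \<Longrightarrow>
      \<bar>word_dist G B (\<phi> g) (\<phi> h) - word_dist G B g h\<bar> \<le> C"
  shows "satisfies_Lipschitz (carrier G) d \<phi>"
proof -
  define D where "D = (3 * C + 2 * word_dist G B p (\<phi> p)) / 2"
  interpret d: Metric_space "carrier G" d
    using d by (simp add: visual_metrics_def)
  have base: "word_dist G B p (\<phi> g) \<ge> word_dist G B p g - C - word_dist G B p (\<phi> p)"
    if "g \<in> carrier G" for g
    using word_dist_triangle[of "\<phi> p" p "\<phi> g"] word_dist_commute[of "\<phi> p" p] dist[of p g]
      that p closed by fastforce
  have gromov: "gromov_product G B p (\<phi> g) (\<phi> h) \<ge> gromov_product G B p g h - D"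
    if "g \<in> carrier G" "h \<in> carrier G" for g h
    using base[of g] base[of h] dist[of g h] that
    unfolding gromov_product_def D_def by (simp add: field_simps abs_le_iff)
  have "d (\<phi> g) (\<phi> h) \<le> (T * T * exp (\<gamma> * D)) * d g h"
    if gh: "g \<in> carrier G" "h \<in> carrier G" for g h
  proof (cases "\<phi> g = \<phi> h")
    case True
    then have "d (\<phi> g) (\<phi> h) = 0"
      using gh closed by simp
    then show ?thesis
      using pos by simp
  next
    case False
    then have "d (\<phi> g) (\<phi> h) \<le> T * exp (- \<gamma> * gromov_product G B p (\<phi> g) (\<phi> h))"
      using d gh closed by (auto simp: visual_metrics_def visual_rho_def)
    also have "\<dots> \<le> T * exp (\<gamma> * D - \<gamma> * gromov_product G B p g h)"
      using mult_left_mono[OF gromov[OF gh], of \<gamma>] pos by (simp add: algebra_simps)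
    also have "\<dots> = (T * exp (\<gamma> * D)) * exp (- \<gamma> * gromov_product G B p g h)"
      by (simp add: exp_diff exp_minus field_simps)
    also have "\<dots> \<le> (T * exp (\<gamma> * D)) * (T * d g h)"
    proof (intro mult_left_mono)
      have "1 / T * exp (- \<gamma> * gromov_product G B p g h) \<le> d g h"
        using d gh False by (auto simp: visual_metrics_def visual_rho_def)
      then show "exp (- \<gamma> * gromov_product G B p g h) \<le> T * d g h"
        using pos by (simp add: field_simps)
    qed (use pos in simp)
    finally show ?thesis
      by (simp add: mult_ac)
  qed
  then show ?thesis
    unfolding satisfies_Lipschitz_def using pos
    by (intro exI[of _ "T * T * exp (\<gamma> * D)"]) simp
qed

text \<open>Apply the Lipschitz condition to \<open>g\<close> and its neighbour \<open>g \<otimes> x\<close>: their Gromov product is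
  \<open>len g\<close> up to a constant, while that of their images is at most \<open>len (\<phi> g)\<close>.\<close>

lemma len_image_if_Lipschitz:
  assumes d: "d \<in> visual_metrics G B \<one> \<gamma> T" and pos: "\<gamma> > 0" "T \<ge> 1"
    and closed: "\<And>g. g \<in> carrier G \<Longrightarrow> \<phi> g \<in> carrier G" and inj: "inj_on \<phi> (carrier G)"
    and x: "x \<in> carrier G" "x \<noteq> \<one>"
    and Lip: "satisfies_Lipschitz (carrier G) d \<phi>"
  shows "\<exists>C::real. \<forall>g\<in>carrier G. len g \<le> len (\<phi> g) + C"
proof -
  obtain K where K: "K > 0" "\<And>g h. g \<in> carrier G \<Longrightarrow> h \<in> carrier G \<Longrightarrow> d (\<phi> g) (\<phi> h) \<le> K * d g h"
    using Lip unfolding satisfies_Lipschitz_def by blast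
  have "len g \<le> len (\<phi> g) + (len x + ln (K * T * T) / \<gamma>)" if g: "g \<in> carrier G" for g
  proof -
    let ?h = "g \<otimes> x"
    have h: "?h \<in> carrier G" "g \<noteq> ?h"
      using g x by auto
    have "\<phi> g \<noteq> \<phi> ?h"
      using inj g h by (auto dest: inj_onD)
    have "word_dist G B g ?h = len x"
      using word_dist_mult_left[of g \<one> x] g x by (simp add: word_dist_one)
    then have 1: "real (len g) - len x \<le> gromov_product G B \<one> g ?h"
      using word_dist_triangle[of \<one> ?h g] word_dist_commute[of g ?h] g h
      by (simp add: gromov_product_def word_dist_one)
    have 2: "gromov_product G B \<one> (\<phi> g) (\<phi> ?h) \<le> len (\<phi> g)"
      using word_dist_triangle[of \<one> "\<phi> g" "\<phi> ?h"] g h closed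
      by (simp add: gromov_product_def word_dist_one)
    have "1 / T * exp (- \<gamma> * len (\<phi> g)) \<le> 1 / T * exp (- \<gamma> * gromov_product G B \<one> (\<phi> g) (\<phi> ?h))"
      using 2 pos by (intro mult_left_mono) auto
    also have "\<dots> \<le> d (\<phi> g) (\<phi> ?h)"
      using d g h closed \<open>\<phi> g \<noteq> \<phi> ?h\<close> by (auto simp: visual_metrics_def visual_rho_def)
    also have "\<dots> \<le> K * d g ?h"
      using K g h by blast
    also have "\<dots> \<le> K * (T * exp (- \<gamma> * gromov_product G B \<one> g ?h))"
      using d g h K by (intro mult_left_mono) (auto simp: visual_metrics_def visual_rho_def)
    also have "\<dots> \<le> K * (T * exp (- \<gamma> * (real (len g) - len x)))"
      using 1 pos K by (intro mult_left_mono) auto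
    finally have "exp (- \<gamma> * len (\<phi> g)) \<le> K * T * T * exp (- \<gamma> * (real (len g) - len x))"
      using pos by (simp add: field_simps)
    then have "ln (exp (- \<gamma> * len (\<phi> g))) \<le> ln (K * T * T * exp (- \<gamma> * (real (len g) - len x)))"
      by (rule ln_mono) simp
    then have "- \<gamma> * len (\<phi> g) \<le> ln (K * T * T) - \<gamma> * (real (len g) - len x)"
      using K pos by (simp add: ln_mult)
    then show ?thesis
      using pos by (simp add: field_simps)
  qed
  then show ?thesis
    by blast
qed

end

section \<open>The free group as a group of words\<close>

lemma carrier_free_group: "w \<in> carrier (free_group A) \<longleftrightarrow> reduced w \<and> fst ` set w \<subseteq> A"
  by (simp add: free_group_def)

lemma mult_free_group [simp]: "u \<otimes>\<^bsub>free_group A\<^esub> v = reduce (u @ v)"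
  by (simp add: free_group_def)

lemma one_free_group [simp]: "\<one>\<^bsub>free_group A\<^esub> = []"
  by (simp add: free_group_def)

lemma winv_closed: "w \<in> carrier (free_group A) \<Longrightarrow> winv w \<in> carrier (free_group A)"
  by (simp add: carrier_free_group)

lemma sublist_closed:
  "v \<in> carrier (free_group A) \<Longrightarrow> sublist u v \<Longrightarrow> u \<in> carrier (free_group A)"
  unfolding carrier_free_group sublist_def
  by (elim exE conjE) (simp add: image_Un reduced_append_iff)

lemma inv_free_group:
  assumes "w \<in> carrier (free_group A)"
  shows "inv\<^bsub>free_group A\<^esub> w = winv w"
  using assms winv_closed by (intro group.inv_equality[OF group_free_group]) auto

lemma pow_free_group: "w [^]\<^bsub>free_group A\<^esub> (n::nat) = reduce (wpow n w)"
proof (induction n)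
  case (Suc n)
  then show ?case
    by (simp only: monoid.nat_pow_Suc[OF group.is_monoid[OF group_free_group]] mult_free_group
        reduce_append_left wpow_Suc_right)
qed (simp add: monoid.nat_pow_0[OF group.is_monoid[OF group_free_group]])

lemma free_group_induct [consumes 1, case_names Nil Cons]:
  assumes "w \<in> carrier (free_group A)"
    and "P []"
    and "\<And>x w. [x] \<in> carrier (free_group A) \<Longrightarrow> w \<in> carrier (free_group A) \<Longrightarrow>
      reduce ([x] @ w) = x # w \<Longrightarrow> P w \<Longrightarrow> P (x # w)"
  shows "P w"
  using assms(1)
proof (induction w)
  case (Cons x w)
  then have "w \<in> carrier (free_group A)" "[x] \<in> carrier (free_group A)"
    using sublist_closed[OF Cons.prems] by (simp_all add: sublist_Cons_right)
  moreover have "reduce ([x] @ w) = x # w"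
    using Cons.prems by (simp add: reduce_reduced carrier_free_group)
  ultimately show ?case
    using Cons.IH assms(3) by blast
qed (rule assms(2))

lemma generate_letters:
  assumes "w \<in> carrier (free_group A)" "(\<lambda>a. [(a, True)]) ` A \<subseteq> B"
  shows "w \<in> generate (free_group A) B"
  using assms(1)
proof (induction rule: free_group_induct)
  case Nil
  then show ?case using generate.one[of "free_group A" B] by simp
next
  case (Cons x w)
  obtain a b where x: "x = (a, b)" by fastforce
  have a: "a \<in> A" and mem: "[(a, True)] \<in> B"
    using Cons x assms(2) by (auto simp: carrier_free_group)
  then have "inv\<^bsub>free_group A\<^esub> [(a, True)] = [(a, False)]"
    by (subst inv_free_group) (auto simp: carrier_free_group)
  then have "[x] \<in> generate (free_group A) B"
    using generate.incl[OF mem, of "free_group A"] generate.inv[OF mem, of "free_group A"] x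
    by (cases b) simp_all
  from generate.eng[OF this Cons.IH] Cons show ?case
    by simp
qed


section \<open>Visual metrics on free groups\<close>

locale free_word_metric = word_metric "free_group A" B
  for A :: "'a set" and B :: "'a letter list set"
begin

lemma len_winv: "w \<in> carrier (free_group A) \<Longrightarrow> len (winv w) = len w"
  using len_inv[of w] by (simp add: inv_free_group)

lemma len_reduce:
  assumes "u \<in> carrier (free_group A)" "v \<in> carrier (free_group A)"
  shows "len (reduce (u @ v)) \<le> len u + len v"
  using len_mult[OF assms] by simp

text \<open>A path from the empty word to \<open>u @ v\<close> passes close to \<open>u\<close>, as the Cayley graph with respect
  to the letters is a tree.\<close>

lemma ex_split_near:
  assumes M: "\<And>x t. x \<in> gens \<Longrightarrow> sublist t x \<Longrightarrow> len t \<le> M"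
    and "set xs \<subseteq> gens" "product xs = u @ v"
  shows "\<exists>ys zs. xs = ys @ zs \<and> len (reduce (product zs @ winv v)) \<le> 2 * M"
  using assms(2,3)
proof (induction xs arbitrary: u)
  case Nil
  then show ?case by (intro exI[of _ "[]"]) (use len_one in auto)
next
  case (Cons x xs)
  define P where "P = product xs"
  have gens: "x \<in> gens" "set xs \<subseteq> gens"
    using Cons.prems by simp_all
  have x: "x \<in> carrier (free_group A)" and P: "P \<in> carrier (free_group A)"
    using gens gens_closed unfolding P_def by (blast intro: product_closed)+
  obtain x' t p where *: "x = x' @ t" "P = winv t @ p" "reduce (x @ P) = x' @ p"
    using reduce_append_cancellation[of x P] x P by (auto simp: carrier_free_group)
  have "x \<otimes>\<^bsub>free_group A\<^esub> P = u @ v"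
    using Cons.prems(2) by (simp only: foldr_Cons o_apply P_def)
  then have eq: "x' @ p = u @ v"
    by (simp add: *(3))
  show ?case
  proof (cases "\<exists>u0. P = u0 @ v")
    case True
    then obtain u0 where "product xs = u0 @ v"
      unfolding P_def by blast
    from Cons.IH[OF gens(2) this] obtain ys zs
      where "xs = ys @ zs" "len (reduce (product zs @ winv v)) \<le> 2 * M"
      by blast
    then show ?thesis
      by (metis append_Cons)
  next
    case False
    then obtain r where r: "x' = u @ r" "v = r @ p"
      using eq * by (auto simp: append_eq_append_conv2)
    have sub: "sublist t x" "sublist r x"
      using * r sublist_appendI[of t "u @ r" "[]"] sublist_appendI[of r u t] by simp_all
    then have mem: "t \<in> carrier (free_group A)" "r \<in> carrier (free_group A)"
      using sublist_closed[OF x] by blast+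
    have "reduce (P @ winv v) = reduce (winv t @ winv r)"
      using reduce_cancel_mid[of "p @ winv p" "winv t" "winv r"] * r by simp
    then have "len (reduce (P @ winv v)) \<le> len t + len r"
      using len_reduce[of "winv t" "winv r"] mem by (simp add: winv_closed len_winv)
    also have "\<dots> \<le> 2 * M"
      using M[OF gens(1) sub(1)] M[OF gens(1) sub(2)] by simp
    finally show ?thesis
      unfolding P_def by (metis append_Cons append_Nil)
  qed
qed

lemma len_append_almost_additive:
  "\<exists>C. \<forall>u v. u @ v \<in> carrier (free_group A) \<longrightarrow> len u + len v \<le> len (u @ v) + C"
proof -
  let ?S = "\<Union>x\<in>gens. {t. sublist t x}"
  define M where "M = Max (insert 0 (len ` ?S))"
  have "finite {t. sublist t x}" for x :: "'a letter list"
    using finite_set[of "sublists x"] by (simp add: set_sublists_eq)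
  then have "finite ?S"
    using finite_gens by blast
  then have M: "len t \<le> M" if "x \<in> gens" "sublist t x" for x t
    unfolding M_def using that by (intro Max_ge) auto
  have "len u + len v \<le> len (u @ v) + 4 * M" if uv: "u @ v \<in> carrier (free_group A)" for u v
  proof -
    obtain xs where xs: "set xs \<subseteq> gens" "product xs = u @ v" "length xs = len (u @ v)"
      using ex_geodesic[OF uv] by blast
    have "\<exists>ys zs. xs = ys @ zs \<and> len (reduce (product zs @ winv v)) \<le> 2 * M"
      by (rule ex_split_near[OF _ xs(1,2)]) (rule M)
    then obtain ys zs where split: "xs = ys @ zs" and near: "len (reduce (product zs @ winv v)) \<le> 2 * M"
      by blast
    have mem: "u \<in> carrier (free_group A)" "v \<in> carrier (free_group A)"
      using uv sublist_closed[OF uv] by auto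
    have gens: "set ys \<subseteq> gens" "set zs \<subseteq> gens"
      using xs(1) split by auto
    define Y Z e where "Y = product ys" and "Z = product zs" and "e = reduce (Z @ winv v)"
    have closed: "set ys \<subseteq> carrier (free_group A)" "set zs \<subseteq> carrier (free_group A)"
      using gens gens_closed by blast+
    have Y: "Y \<in> carrier (free_group A)" "len Y \<le> length ys"
      and Z: "Z \<in> carrier (free_group A)" "len Z \<le> length zs"
      unfolding Y_def Z_def by (intro product_closed closed len_product_le gens)+
    have e: "e \<in> carrier (free_group A)"
      using m_closed[of Z "winv v"] Z mem by (simp add: e_def winv_closed)
    have "Y \<otimes>\<^bsub>free_group A\<^esub> Z = u @ v"
      using product_append[OF closed] xs(2) by (simp only: split Y_def Z_def)
    then have YZ: "reduce (Y @ Z) = u @ v"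
      by simp
    have "reduce (Y @ e) = reduce (reduce (Y @ Z) @ winv v)"
      unfolding e_def by (simp only: reduce_append_left reduce_append_right append_assoc)
    also have "\<dots> = reduce u"
      using reduce_cancel_mid[of "v @ winv v" u "[]"] by (simp add: YZ)
    finally have "len u \<le> len Y + len e"
      using len_reduce[OF Y(1) e] mem by (simp add: carrier_free_group reduce_reduced)
    moreover have "reduce (winv e @ Z) = reduce ((v @ winv Z) @ Z)"
      unfolding e_def using reduce_append_left[of "v @ winv Z" Z] by (simp flip: reduce_winv)
    then have "reduce (winv e @ Z) = v"
      using reduce_cancel_mid[of "winv Z @ Z" v "[]"] mem
      by (simp add: carrier_free_group reduce_reduced)
    then have "len v \<le> len e + len Z"
      using len_reduce[of "winv e" Z] e Z by (simp add: winv_closed len_winv)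
    ultimately show ?thesis
      using near Y Z xs(3) split by (simp add: e_def Z_def)
  qed
  then show ?thesis by blast
qed

definition prefix_len :: "'a letter list \<Rightarrow> nat" where
  "prefix_len w = Max (len ` {p. prefix p w})"

lemma finite_prefixes: "finite {p. prefix p w}"
  using finite_set[of "prefixes w"] by (simp add: set_prefixes_eq)

lemma prefix_len_mono: "prefix u w \<Longrightarrow> prefix_len u \<le> prefix_len w"
  unfolding prefix_len_def using finite_prefixes
  by (intro Max_mono) (auto intro: prefix_order.trans)

definition tree_metric :: "'a letter list \<Rightarrow> 'a letter list \<Rightarrow> real" where
  "tree_metric g h = (if g = h then 0 else exp (- real (prefix_len (longest_common_prefix g h))))"

lemma longest_common_prefix_commute: "longest_common_prefix g h = longest_common_prefix h g"
  by (meson longest_common_prefix_max_prefix longest_common_prefix_prefix1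
      longest_common_prefix_prefix2 prefix_order.antisym)

lemma tree_metric_ultra: "tree_metric x z \<le> max (tree_metric x y) (tree_metric y z)"
proof (cases "x = y \<or> y = z \<or> x = z")
  case False
  let ?p = "longest_common_prefix x y" and ?q = "longest_common_prefix y z"
  have pq: "prefix ?p x" "prefix ?p y" "prefix ?q y" "prefix ?q z"
    by (simp_all add: longest_common_prefix_prefix1 longest_common_prefix_prefix2)
  then have "prefix ?p ?q \<or> prefix ?q ?p"
    by (metis prefix_same_cases)
  then have "prefix ?p (longest_common_prefix x z) \<or> prefix ?q (longest_common_prefix x z)"
    using pq by (meson longest_common_prefix_max_prefix prefix_order.trans)
  then have "prefix_len ?p \<le> prefix_len (longest_common_prefix x z) \<or>
      prefix_len ?q \<le> prefix_len (longest_common_prefix x z)"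
    using prefix_len_mono by blast
  then show ?thesis
    using False by (auto simp: tree_metric_def le_max_iff_disj)
qed (auto simp: tree_metric_def le_max_iff_disj)

lemma Metric_space_tree_metric: "Metric_space (carrier (free_group A)) tree_metric"
proof
  fix x y z :: "'a letter list"
  show nonneg: "0 \<le> tree_metric u v" for u v
    by (simp add: tree_metric_def)
  show "tree_metric x y = tree_metric y x"
    by (simp add: tree_metric_def longest_common_prefix_commute)
  show "tree_metric x y = 0 \<longleftrightarrow> x = y"
    by (simp add: tree_metric_def)
  show "tree_metric x z \<le> tree_metric x y + tree_metric y z"
    using tree_metric_ultra[of x z y] nonneg[of x y] nonneg[of y z] by linarith
qed

lemma ex_visual_metric: "\<exists>d T. T \<ge> 1 \<and> d \<in> visual_metrics (free_group A) B [] 1 T"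
proof -
  let ?G = "free_group A"
  obtain C where C: "\<And>u v. u @ v \<in> carrier ?G \<Longrightarrow> len u + len v \<le> len (u @ v) + C"
    using len_append_almost_additive by blast
  have sub: "len (u @ v) \<le> len u + len v" if "u @ v \<in> carrier ?G" for u v
  proof -
    have "u \<in> carrier ?G" "v \<in> carrier ?G"
      using sublist_closed[OF that] by auto
    then show ?thesis
      using len_reduce[of u v] that by (simp add: carrier_free_group reduce_reduced)
  qed
  have close: "\<bar>gromov_product ?G B [] g h - prefix_len (longest_common_prefix g h)\<bar> \<le> 3 * real C"
    if g: "g \<in> carrier ?G" and h: "h \<in> carrier ?G" for g h
  proof -
    define m where "m = longest_common_prefix g h"
    obtain g' h' where eq: "g = m @ g'" "h = m @ h'"
      using longest_common_prefix_prefix1 longest_common_prefix_prefix2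
      unfolding m_def by (metis prefixE)
    have mem: "m \<in> carrier ?G" "g' \<in> carrier ?G" "h' \<in> carrier ?G"
      using sublist_closed[OF g] sublist_closed[OF h] eq by auto
    have "hd h' \<noteq> hd g'" if "g' \<noteq> []" "h' \<noteq> []"
    proof
      assume "hd h' = hd g'"
      then have "prefix (m @ [hd g']) g" "prefix (m @ [hd g']) h"
        using that eq by (cases g'; cases h'; simp)+
      then have "prefix (m @ [hd g']) m"
        unfolding m_def by (rule longest_common_prefix_max_prefix)
      then show False
        by simp
    qed
    then have red: "winv g' @ h' \<in> carrier ?G"
      using mem by (auto simp: carrier_free_group reduced_append_iff last_winv image_Un)
    have "inv\<^bsub>?G\<^esub> g \<otimes>\<^bsub>?G\<^esub> h = reduce (winv g' @ (winv m @ m) @ h')"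
      unfolding inv_free_group[OF g] by (simp add: eq)
    also have "\<dots> = winv g' @ h'"
      using reduce_cancel_mid[of "winv m @ m" "winv g'" h'] red
      by (simp add: carrier_free_group reduce_reduced)
    finally have dist: "word_dist ?G B g h = len (winv g' @ h')"
      by (simp add: word_dist_def)
    have gromov: "gromov_product ?G B [] g h = (real (len g) + len h - len (winv g' @ h')) / 2"
      using word_dist_one[OF g] word_dist_one[OF h] dist by (simp add: gromov_product_def)
    have 1: "len m + len g' \<le> len g + C" "len g \<le> len m + len g'"
      using C[of m g'] sub[of m g'] g eq by auto
    have 2: "len m + len h' \<le> len h + C" "len h \<le> len m + len h'"
      using C[of m h'] sub[of m h'] h eq by auto
    have 3: "len g' + len h' \<le> len (winv g' @ h') + C" "len (winv g' @ h') \<le> len g' + len h'"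
      using C[OF red] sub[OF red] mem by (simp_all add: len_winv)
    have 4: "len m \<le> prefix_len m"
      unfolding prefix_len_def using finite_prefixes by (intro Max_ge) auto
    have "len p \<le> len m + C" if p: "prefix p m" for p
    proof -
      obtain q where "m = p @ q"
        using p by (auto elim: prefixE)
      then show ?thesis
        using C[of p q] mem(1) by simp
    qed
    then have 5: "prefix_len m \<le> len m + C"
      unfolding prefix_len_def using finite_prefixes
      by (intro Max.boundedI) auto
    have "len g + len h \<le> 2 * len m + (len g' + len h')"
      using 1 2 by linarith
    then have 6: "len g + len h \<le> 2 * prefix_len m + len (winv g' @ h') + C"
      using 3 4 by linarith
    have "2 * len m + (len g' + len h') \<le> len g + len h + 2 * C"
      using 1 2 by linarith
    then have 7: "2 * prefix_len m + len (winv g' @ h') \<le> len g + len h + 4 * C"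
      using 3 5 by linarith
    have "real (len g + len h) \<le> real (2 * prefix_len m + len (winv g' @ h') + C)"
      "real (2 * prefix_len m + len (winv g' @ h')) \<le> real (len g + len h + 4 * C)"
      using 6 7 by (simp_all only: of_nat_le_iff)
    then have "real (len g) + len h - len (winv g' @ h') - 2 * prefix_len m \<le> 6 * C"
      "2 * prefix_len m - (real (len g) + len h - len (winv g' @ h')) \<le> 6 * C"
      by simp_all
    then show ?thesis
      unfolding gromov m_def[symmetric] abs_le_iff by (simp add: field_simps)
  qed
  have "1 / exp (3 * real C) * visual_rho ?G B [] 1 g h \<le> tree_metric g h \<and>
      tree_metric g h \<le> exp (3 * real C) * visual_rho ?G B [] 1 g h"
    if gh: "g \<in> carrier ?G" "h \<in> carrier ?G" "g \<noteq> h" for g h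
    using close[OF gh(1,2)] gh(3)
    by (auto simp: tree_metric_def visual_rho_def abs_le_iff simp flip: exp_minus exp_add inverse_eq_divide)
  then have "tree_metric \<in> visual_metrics ?G B [] 1 (exp (3 * real C))"
    using Metric_space_tree_metric by (simp add: visual_metrics_def)
  then show ?thesis
    by (intro exI[of _ tree_metric] exI[of _ "exp (3 * real C)"]) auto
qed

end

section \<open>Counting occurrences\<close>

definition positions :: "'a list \<Rightarrow> 'a list \<Rightarrow> nat set" where
  "positions s w = {i. i + length s \<le> length w \<and> take (length s) (drop i w) = s}"

definition occurrences :: "'a list \<Rightarrow> 'a list \<Rightarrow> nat" where
  "occurrences s w = card (positions s w)"

lemma finite_positions [simp]: "finite (positions s w)"
  by (rule finite_subset[of _ "{..length w}"]) (auto simp: positions_def)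

lemma occurrences_append_left: "occurrences s u \<le> occurrences s (u @ v)"
  unfolding occurrences_def by (intro card_mono[OF finite_positions]) (auto simp: positions_def)

lemma positions_shift: "(\<lambda>i. i + length u) ` positions s v = positions s (u @ v) \<inter> {length u..}"
proof (intro equalityI subsetI)
  fix i assume "i \<in> positions s (u @ v) \<inter> {length u..}"
  then show "i \<in> (\<lambda>i. i + length u) ` positions s v"
    by (intro image_eqI[of _ _ "i - length u"]) (auto simp: positions_def)
qed (auto simp: positions_def)

lemma card_positions_shift: "card ((\<lambda>i. i + length u) ` positions s v) = occurrences s v"
  unfolding occurrences_def by (intro card_image) (simp add: inj_on_def)

lemma occurrences_append_right: "occurrences s v \<le> occurrences s (u @ v)"
proof -
  have "card ((\<lambda>i. i + length u) ` positions s v) \<le> card (positions s (u @ v))"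
    unfolding positions_shift by (intro card_mono) auto
  then show ?thesis
    unfolding card_positions_shift by (simp add: occurrences_def)
qed

lemma occurrences_append_le:
  "occurrences s (u @ v) \<le> occurrences s u + occurrences s v + length s"
proof -
  let ?P = "(\<lambda>i. i + length u) ` positions s v" and ?Q = "{length u - length s..<length u}"
  have "positions s (u @ v) \<subseteq> positions s u \<union> ?P \<union> ?Q"
    unfolding positions_shift by (auto simp: positions_def)
  then have "occurrences s (u @ v) \<le> card (positions s u \<union> ?P \<union> ?Q)"
    unfolding occurrences_def by (intro card_mono) auto
  also have "\<dots> \<le> card (positions s u) + card ?P + card ?Q"
    using card_Un_le[of "positions s u \<union> ?P" ?Q] card_Un_le[of "positions s u" ?P] by linarith
  also have "\<dots> \<le> occurrences s u + occurrences s v + length s"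
    unfolding card_positions_shift by (simp add: occurrences_def)
  finally show ?thesis .
qed

lemma occurrences_reduce_le:
  assumes "reduced u" "reduced v"
  shows "occurrences s (reduce (u @ v)) \<le> occurrences s u + occurrences s v + length s"
proof -
  obtain u' t v' where *: "u = u' @ t" "v = winv t @ v'" "reduce (u @ v) = u' @ v'"
    using reduce_append_cancellation[OF assms] by blast
  then show ?thesis
    using occurrences_append_le[of s u' v'] occurrences_append_left[of s u' t]
      occurrences_append_right[of s v' "winv t"] by simp
qed

lemma occurrences_eq_0:
  assumes "\<not> sublist s w"
  shows "occurrences s w = 0"
proof -
  have "positions s w = {}"
  proof (rule ccontr)
    assume "positions s w \<noteq> {}"
    then obtain i where "take (length s) (drop i w) = s"
      by (auto simp: positions_def)
    then have "w = take i w @ s @ drop (length s) (drop i w)"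
      by (metis append_take_drop_id)
    with assms show False
      by (metis sublist_appendI)
  qed
  then show ?thesis
    by (simp add: occurrences_def)
qed

lemma occurrences_singleton_le:
  assumes "s \<noteq> []"
  shows "occurrences s [x] \<le> 1"
proof -
  have "positions s [x] \<subseteq> {0}"
    using assms by (cases s) (auto simp: positions_def)
  then have "card (positions s [x]) \<le> card {0::nat}"
    by (intro card_mono) auto
  then show ?thesis
    by (simp add: occurrences_def)
qed

lemma occurrences_wpow_ge:
  assumes "s \<noteq> []"
  shows "n \<le> occurrences s (wpow n s)"
proof (induction n)
  case (Suc n)
  let ?P = "(\<lambda>i. i + length s) ` positions s (wpow n s)"
  have "insert 0 ?P \<subseteq> positions s (s @ wpow n s)"
    unfolding positions_shift by (auto simp: positions_def)
  then have "card (insert 0 ?P) \<le> occurrences s (wpow (Suc n) s)"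
    unfolding occurrences_def by (simp add: card_mono)
  moreover have "0 \<notin> ?P"
    using assms by auto
  ultimately show ?case
    using Suc by (simp add: card_positions_shift)
qed simp

lemma (in free_word_metric) occurrences_le_len:
  assumes "\<And>x. x \<in> gens \<Longrightarrow> occurrences s x \<le> 1" "w \<in> carrier (free_group A)"
  shows "occurrences s w \<le> (length s + 1) * len w + occurrences s []"
proof -
  have "occurrences s (product xs) \<le> (length s + 1) * length xs + occurrences s []"
    if "set xs \<subseteq> gens" for xs
    using that
  proof (induction xs)
    case (Cons x xs)
    define P where "P = product xs"
    have gens: "x \<in> gens" "set xs \<subseteq> gens"
      using Cons.prems by simp_all
    then have "x \<in> carrier (free_group A)" "P \<in> carrier (free_group A)"
      unfolding P_def using gens_closed by (blast intro: product_closed)+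
    then have "occurrences s (reduce (x @ P)) \<le> occurrences s x + occurrences s P + length s"
      by (intro occurrences_reduce_le) (auto simp: carrier_free_group)
    also have "\<dots> \<le> 1 + ((length s + 1) * length xs + occurrences s []) + length s"
      using Cons.IH[OF gens(2)] assms(1)[OF gens(1)] unfolding P_def by linarith
    finally have "occurrences s (x \<otimes>\<^bsub>free_group A\<^esub> P) \<le>
        (length s + 1) * length (x # xs) + occurrences s []"
      by simp
    then show ?case
      by (simp only: foldr_Cons o_apply P_def)
  qed simp
  moreover obtain xs where "set xs \<subseteq> gens" "product xs = w" "length xs = len w"
    using ex_geodesic[OF assms(2)] by blast
  ultimately show ?thesis
    by metis
qed

lemma sublist_winv: "sublist (winv u) (winv v) \<longleftrightarrow> sublist u v"
proof -
  have "sublist (winv u) (winv v)" if "sublist u v" for u v :: "'a letter list"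
    using that by (simp add: winv_def map_mono_sublist)
  from this[of u v] this[of "winv u" "winv v"] show ?thesis
    by auto
qed

text \<open>If no power of \<open>\<phi> u\<close> contains \<open>s = u\<^sup>k\<close> or its inverse, then adjoining a high power of
  \<open>\<phi> u\<close> to the letters makes the powers of \<open>\<phi> u\<close> short, while the powers of \<open>u\<close> stay long because
  multiplication by a generator creates at most \<open>length s + 1\<close> new occurrences of \<open>s\<close>.\<close>

lemma powers_occur_if_Lipschitz:
  assumes "finite A" and \<phi>: "\<phi> \<in> hom (free_group A) (free_group A)"
    and inj: "inj_on \<phi> (carrier (free_group A))"
    and Lip: "\<And>d. visual_metric (free_group A) d \<Longrightarrow>
      satisfies_Lipschitz (carrier (free_group A)) d \<phi>"
    and u: "u \<in> carrier (free_group A)" "u \<noteq> []" "cyc_reduced u"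
  shows "powers_occur u (\<phi> u)"
proof (rule ccontr)
  let ?G = "free_group A"
  interpret G: group ?G
    by (rule group_free_group)
  interpret \<phi>: group_hom ?G ?G \<phi>
    by unfold_locales (rule \<phi>)
  assume "\<not> powers_occur u (\<phi> u)"
  then obtain k where k: "\<And>n. \<not> sublist (wpow k u) (reduce (wpow n (\<phi> u)))"
      "\<And>n. \<not> sublist (wpow k (winv u)) (reduce (wpow n (\<phi> u)))"
    unfolding powers_occur_def by blast
  define s where "s = wpow k u"
  define D where "D = length s + 1"
  define N where "N = k * (2 * D)"
  define b where "b = \<phi> u [^]\<^bsub>?G\<^esub> N"
  define B where "B = insert b ((\<lambda>a. [(a, True)]) ` A)"
  have "s \<noteq> []"
    using k(1)[of 0] unfolding s_def by auto
  have b: "b \<in> carrier ?G"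
    using u by (simp add: b_def)
  have b_eq: "b = reduce (wpow N (\<phi> u))"
    by (simp add: b_def pow_free_group)
  have B: "B \<subseteq> carrier ?G"
    using b by (auto simp: B_def carrier_free_group)
  have "generate ?G B = carrier ?G"
    using G.generate_incl[OF B] generate_letters[of _ A B] by (auto simp: B_def)
  then interpret free_word_metric A B
    using B assms(1) by unfold_locales (auto simp: finite_generating_set_def B_def)
  have occ: "occurrences s x \<le> 1" if "x \<in> gens" for x
  proof -
    have inv: "inv\<^bsub>?G\<^esub> y = winv y" if "y \<in> B" for y
      using that B inv_free_group by blast
    have "\<not> sublist s b" "\<not> sublist s (winv b)"
      using k sublist_winv[of "winv s" b] unfolding b_eq s_def by (simp_all add: winv_wpow)
    then show ?thesis
      using that inv occurrences_eq_0[of s] occurrences_singleton_le[OF \<open>s \<noteq> []\<close>]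
      by (auto simp: B_def)
  qed
  have gn: "wpow (2 * D * n) s = u [^]\<^bsub>?G\<^esub> (2 * D * n * k)" for n
    using reduce_reduced[OF reduced_wpow[OF u(3)]] by (simp add: s_def pow_free_group flip: wpow_mult)
  have long: "2 * n \<le> len (wpow (2 * D * n) s)" for n
  proof -
    have "occurrences s [] = 0"
      using \<open>s \<noteq> []\<close> by (intro occurrences_eq_0) simp
    moreover have "wpow (2 * D * n) s \<in> carrier ?G"
      unfolding gn using u by simp
    ultimately have "2 * D * n \<le> D * len (wpow (2 * D * n) s)"
      using occurrences_le_len[OF occ, of "wpow (2 * D * n) s"]
        occurrences_wpow_ge[OF \<open>s \<noteq> []\<close>, of "2 * D * n"] by (simp add: D_def)
    then have "D * (2 * n) \<le> D * len (wpow (2 * D * n) s)"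
      by (simp add: mult_ac)
    moreover have "D > 0"
      by (simp add: D_def)
    ultimately show ?thesis
      by (simp only: mult_le_cancel1)
  qed
  have short: "len (\<phi> (wpow (2 * D * n) s)) \<le> n" for n
  proof -
    have "\<phi> (wpow (2 * D * n) s) = \<phi> u [^]\<^bsub>?G\<^esub> (N * n)"
      unfolding gn using u by (simp add: \<phi>.hom_nat_pow N_def mult_ac)
    also have "\<dots> = b [^]\<^bsub>?G\<^esub> n"
      using u by (simp add: b_def G.nat_pow_pow)
    finally have "len (\<phi> (wpow (2 * D * n) s)) \<le> n * len b"
      using len_pow[OF b] by simp
    moreover have "len b \<le> 1"
      by (intro len_gens) (simp add: B_def)
    ultimately show ?thesis
      by (metis mult.right_neutral mult_le_mono2 order_trans)
  qed
  obtain d T where d: "T \<ge> 1" "d \<in> visual_metrics ?G B [] 1 T"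
    using ex_visual_metric by blast
  have "visual_metric ?G d"
    unfolding visual_metric_def using d generating
    by (intro exI[of _ B] exI[of _ "[]"] exI[of _ 1] exI[of _ T]) (simp add: carrier_free_group)
  then obtain C where C: "\<And>g. g \<in> carrier ?G \<Longrightarrow> len g \<le> len (\<phi> g) + (C::real)"
    using len_image_if_Lipschitz[of d 1 T \<phi> u] d inj Lip u by auto
  obtain n :: nat where n: "C < n"
    using reals_Archimedean2 by blast
  have "wpow (2 * D * n) s \<in> carrier ?G"
    unfolding gn using u by simp
  then have "real (len (wpow (2 * D * n) s)) \<le> len (\<phi> (wpow (2 * D * n) s)) + C"
    by (rule C)
  then show False
    using long[of n] short[of n] n by linarith
qed

section \<open>Endomorphisms preserving the powers\<close>

definition preserves_powers :: "'a set \<Rightarrow> ('a letter list \<Rightarrow> 'a letter list) \<Rightarrow> bool" where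
  "preserves_powers A \<phi> \<longleftrightarrow> \<phi> \<in> hom (free_group A) (free_group A) \<and>
    (\<forall>u\<in>carrier (free_group A). u \<noteq> [] \<longrightarrow> cyc_reduced u \<longrightarrow> powers_occur u (\<phi> u))"

definition conjugate ::
    "'a letter list \<Rightarrow> ('a letter list \<Rightarrow> 'a letter list) \<Rightarrow> 'a letter list \<Rightarrow> 'a letter list" where
  "conjugate z \<phi> g = reduce (z @ \<phi> g @ winv z)"

lemma conjugate_conjugate: "conjugate y (conjugate z \<phi>) g = conjugate (reduce (y @ z)) \<phi> g"
proof -
  have "conjugate y (conjugate z \<phi>) g = reduce (y @ (z @ \<phi> g @ winv z) @ winv y)"
    unfolding conjugate_def
    using reduce_cong_append[OF refl reduce_append_left[of "z @ \<phi> g @ winv z" "winv y"]]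
    by simp
  also have "\<dots> = reduce ((y @ z) @ \<phi> g @ winv (y @ z))"
    by simp
  also have "\<dots> = reduce (reduce (y @ z) @ \<phi> g @ winv (reduce (y @ z)))"
    unfolding reduce_winv[symmetric] by (intro reduce_cong_append) simp_all
  finally show ?thesis
    by (simp add: conjugate_def)
qed

lemma preserves_powers_conjugate:
  assumes "preserves_powers A \<phi>" "z \<in> carrier (free_group A)"
  shows "preserves_powers A (conjugate z \<phi>)"
proof -
  let ?G = "free_group A"
  interpret G: group ?G
    by (rule group_free_group)
  have \<phi>: "\<phi> \<in> hom ?G ?G"
    and pow: "\<And>u. u \<in> carrier ?G \<Longrightarrow> u \<noteq> [] \<Longrightarrow> cyc_reduced u \<Longrightarrow> powers_occur u (\<phi> u)"
    using assms(1) by (auto simp: preserves_powers_def)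
  have eq: "conjugate z \<phi> g = z \<otimes>\<^bsub>?G\<^esub> \<phi> g \<otimes>\<^bsub>?G\<^esub> inv\<^bsub>?G\<^esub> z" for g
    using inv_free_group[OF assms(2)] reduce_append_left[of "z @ \<phi> g" "winv z"]
    by (simp add: conjugate_def)
  have "conjugate z \<phi> \<in> hom ?G ?G"
  proof (rule homI)
    fix g h assume gh: "g \<in> carrier ?G" "h \<in> carrier ?G"
    then have mem: "\<phi> g \<in> carrier ?G" "\<phi> h \<in> carrier ?G"
      using \<phi> by (auto dest: hom_in_carrier)
    show "conjugate z \<phi> g \<in> carrier ?G"
      unfolding eq by (intro G.m_closed mem assms(2) G.inv_closed)
    have "inv\<^bsub>?G\<^esub> z \<otimes>\<^bsub>?G\<^esub> (z \<otimes>\<^bsub>?G\<^esub> (\<phi> h \<otimes>\<^bsub>?G\<^esub> inv\<^bsub>?G\<^esub> z)) = \<phi> h \<otimes>\<^bsub>?G\<^esub> inv\<^bsub>?G\<^esub> z"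
      using mem assms(2) by (simp add: G.m_assoc[symmetric] del: mult_free_group one_free_group)
    then show "conjugate z \<phi> (g \<otimes>\<^bsub>?G\<^esub> h) = conjugate z \<phi> g \<otimes>\<^bsub>?G\<^esub> conjugate z \<phi> h"
      unfolding eq using mem assms(2) hom_mult[OF \<phi> gh] by (simp add: G.m_assoc del: mult_free_group one_free_group)
  qed
  moreover have "powers_occur u (conjugate z \<phi> u)"
    if "u \<in> carrier ?G" "u \<noteq> []" "cyc_reduced u" for u
    unfolding conjugate_def using powers_occur_conj[OF pow[OF that] _ that(2)] assms(2)
    by (simp add: carrier_free_group)
  ultimately show ?thesis
    by (simp add: preserves_powers_def)
qed

lemma reduce_conj_cancel: "reduce (winv z @ (z @ w @ winv z) @ z) = reduce w"
  using reduce_cancel_mid[of "winv z @ z" "winv z @ z @ w" "[]"]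
    reduce_cancel_mid[of "winv z @ z" "[]" w] by simp

lemma preserves_powers_letter:
  assumes "preserves_powers A \<phi>" "a \<in> A"
  shows "\<exists>z n s. \<phi> [(a, True)] = z @ replicate (Suc n) (a, s) @ winv z \<and> z \<in> carrier (free_group A)"
proof -
  have mem: "[(a, True)] \<in> carrier (free_group A)"
    using assms(2) by (simp add: carrier_free_group)
  then have 1: "\<phi> [(a, True)] \<in> carrier (free_group A)"
    using assms(1) by (auto simp: preserves_powers_def dest: hom_in_carrier)
  have "cyc_reduced [(a, True)]"
    by (simp add: cyc_reduced_def reduced_Cons)
  then have "powers_occur [(a, True)] (\<phi> [(a, True)])"
    using assms(1) mem by (simp add: preserves_powers_def)
  then obtain z n s where eq: "\<phi> [(a, True)] = z @ replicate (Suc n) (a, s) @ winv z"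
    using powers_occur_letter 1 by (metis carrier_free_group)
  moreover have "z \<in> carrier (free_group A)"
    using sublist_closed[OF 1] eq by (metis sublist_append_rightI)
  ultimately show ?thesis
    by blast
qed

lemma preserves_powers_two_letters:
  assumes "preserves_powers A \<phi>" "a \<in> A" "b \<in> A" "a \<noteq> b"
    and "\<phi> [(a, True)] = replicate (Suc l) (a, r)"
    and "\<phi> [(b, True)] = y @ replicate (Suc n) (b, s) @ winv y"
  shows "l = 0 \<and> n = 0 \<and> s = r \<and> fst ` set y \<subseteq> {a}"
proof (rule powers_occur_two_letters[OF assms(4) _ assms(6)])
  let ?G = "free_group A" and ?u = "[(a, True), (b, True)]"
  have mem: "[(a, True)] \<in> carrier ?G" "[(b, True)] \<in> carrier ?G" "?u \<in> carrier ?G"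
    and "cyc_reduced ?u"
    using assms(2,3) by (simp_all add: carrier_free_group reduced_Cons cyc_reduced_def)
  then have "powers_occur ?u (\<phi> ?u)"
    using assms(1) by (simp add: preserves_powers_def)
  moreover have "?u = [(a, True)] \<otimes>\<^bsub>?G\<^esub> [(b, True)]"
    using mem by (simp add: carrier_free_group reduce_reduced)
  then have "\<phi> ?u = reduce (\<phi> [(a, True)] @ \<phi> [(b, True)])"
    using assms(1) mem hom_mult[of \<phi> ?G ?G "[(a, True)]" "[(b, True)]"]
    by (simp add: preserves_powers_def)
  ultimately show "powers_occur ?u (reduce (replicate (Suc l) (a, r) @ \<phi> [(b, True)]))"
    using assms(5) by simp
  show "reduced (\<phi> [(b, True)])"
  proof -
    have "\<phi> \<in> hom ?G ?G"
      using assms(1) by (simp add: preserves_powers_def)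
    from hom_in_carrier[OF this mem(2)] show ?thesis
      by (simp only: carrier_free_group)
  qed
qed

lemma hom_eq_map:
  assumes \<phi>: "\<phi> \<in> hom (free_group A) (free_group A)"
    and letters: "\<And>a. a \<in> A \<Longrightarrow> \<phi> [(a, True)] = [f (a, True)]"
    and f: "\<And>x. f (flip x) = flip (f x)"
    and w: "w \<in> carrier (free_group A)"
  shows "\<phi> w = reduce (map f w)"
proof -
  let ?G = "free_group A"
  interpret \<phi>: group_hom ?G ?G \<phi>
    using \<phi> by (simp add: group_hom_def group_hom_axioms_def group_free_group)
  have letter: "\<phi> [x] = [f x]" if "[x] \<in> carrier ?G" for x
  proof (cases "snd x")
    case True
    then show ?thesis
      using letters[of "fst x"] that by (cases x) (auto simp: carrier_free_group)
  next
    case False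
    define y where "y = flip x"
    have y: "[y] \<in> carrier ?G" "\<phi> [y] = [f y]"
      using letters[of "fst x"] that False by (cases x; auto simp: y_def carrier_free_group)+
    have "[x] = inv\<^bsub>?G\<^esub> [y]"
      using y(1) by (simp add: inv_free_group y_def)
    then have "\<phi> [x] = inv\<^bsub>?G\<^esub> [f y]"
      using \<phi>.hom_inv[OF y(1)] y(2) by simp
    also have "\<dots> = [f x]"
      using \<phi>.hom_closed[OF y(1)] y(2) f[of y] by (simp add: inv_free_group y_def)
    finally show ?thesis .
  qed
  from w show ?thesis
  proof (induction rule: free_group_induct)
    case Nil
    then show ?case
      using \<phi>.hom_one by simp
  next
    case (Cons x w)
    have "\<phi> (x # w) = reduce (\<phi> [x] @ \<phi> w)"
      using \<phi>.hom_mult[OF Cons(1,2)] Cons(3) by simp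
    then show ?case
      using letter[OF Cons(1)] Cons(4) reduce_append_right[of "[f x]" "map f w"] by simp
  qed
qed

text \<open>After conjugation \<open>\<phi>\<close> fixes every letter or inverts every letter; the latter is excluded
  by \<open>aababb\<close>.\<close>

lemma conjugation_if_preserves_powers:
  assumes pres: "preserves_powers A \<phi>" and ab: "a \<in> A" "b \<in> A" "a \<noteq> b"
  shows "\<exists>x\<in>carrier (free_group A). \<forall>g\<in>carrier (free_group A). \<phi> g = reduce (winv x @ g @ x)"
proof -
  let ?G = "free_group A"
  interpret G: group ?G
    by (rule group_free_group)
  obtain z l r where z: "z \<in> carrier ?G" "\<phi> [(a, True)] = z @ replicate (Suc l) (a, r) @ winv z"
    using preserves_powers_letter[OF pres ab(1)] by blast
  define \<phi>1 where "\<phi>1 = conjugate (winv z) \<phi>"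
  have 1: "preserves_powers A \<phi>1"
    unfolding \<phi>1_def using preserves_powers_conjugate[OF pres] winv_closed z(1) by blast
  have "reduced (replicate (Suc l) (a, r))"
    by (simp add: reduced_def successively_conv_nth nth_Cons split: nat.split)
  then have a1: "\<phi>1 [(a, True)] = replicate (Suc l) (a, r)"
    using reduce_conj_cancel[of z "replicate (Suc l) (a, r)"] z(2)
    by (simp add: \<phi>1_def conjugate_def reduce_reduced)
  obtain y n s where y: "y \<in> carrier ?G" "\<phi>1 [(b, True)] = y @ replicate (Suc n) (b, s) @ winv y"
    using preserves_powers_letter[OF 1 ab(2)] by blast
  have *: "l = 0" "n = 0" "s = r" "fst ` set y \<subseteq> {a}"
    using preserves_powers_two_letters[OF 1 ab a1 y(2)] by auto
  define \<phi>2 where "\<phi>2 = conjugate (winv y) \<phi>1"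
  have 2: "preserves_powers A \<phi>2"
    unfolding \<phi>2_def using preserves_powers_conjugate[OF 1] winv_closed y(1) by blast
  have "reduce (winv y @ [(a, r)] @ y) = reduce (winv y @ y @ [(a, r)])"
    using *(4) by (intro reduce_cong_append refl reduce_commute[of _ _ a]) auto
  also have "\<dots> = [(a, r)]"
    using reduce_cancel_mid[of "winv y @ y" "[]" "[(a, r)]"] by (simp add: reduce_reduced)
  finally have a2: "\<phi>2 [(a, True)] = [(a, r)]"
    using a1 * by (simp add: \<phi>2_def conjugate_def)
  have b2: "\<phi>2 [(b, True)] = [(b, r)]"
    using reduce_conj_cancel[of y "[(b, r)]"] y(2) * by (simp add: \<phi>2_def conjugate_def reduce_reduced)
  have c2: "\<phi>2 [(c, True)] = [(c, r)]" if c: "c \<in> A" for c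
  proof (cases "c = a \<or> c = b")
    case False
    obtain x m t where x: "\<phi>2 [(c, True)] = x @ replicate (Suc m) (c, t) @ winv x"
      using preserves_powers_letter[OF 2 c] by blast
    have "0 = (0::nat) \<and> m = 0 \<and> t = r \<and> fst ` set x \<subseteq> {a}"
      by (rule preserves_powers_two_letters[OF 2 ab(1) c _ _ x]) (use a2 False in auto)
    moreover have "0 = (0::nat) \<and> m = 0 \<and> t = r \<and> fst ` set x \<subseteq> {b}"
      by (rule preserves_powers_two_letters[OF 2 ab(2) c _ _ x]) (use b2 False in auto)
    ultimately show ?thesis
      using x ab(3) by (cases x) auto
  qed (use a2 b2 in auto)
  define f where "f = (\<lambda>x :: 'a letter. if r then x else flip x)"
  have eq: "\<phi>2 w = reduce (map f w)" if "w \<in> carrier ?G" for w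
    using 2 c2 that
    by (intro hom_eq_map) (auto simp: preserves_powers_def f_def)
  have r
  proof (rule ccontr)
    assume "\<not> r"
    define u where "u = [(a, True), (a, True), (b, True), (a, True), (b, True), (b, True)]"
    have u: "u \<in> carrier ?G" "cyc_reduced u" "u \<noteq> []" "reduced (map flip u)"
      using ab by (simp_all add: u_def carrier_free_group cyc_reduced_def reduced_Cons)
    have "\<phi>2 u = map flip u"
      using eq[OF u(1)] \<open>\<not> r\<close> u(4) by (simp add: f_def reduce_reduced)
    moreover have "powers_occur u (\<phi>2 u)"
      using 2 u by (simp add: preserves_powers_def)
    ultimately show False
      using powers_occur_not_flip[OF ab(3) u_def] by simp
  qed
  define x where "x = reduce (winv y @ winv z)"
  have x: "x \<in> carrier ?G"
    using G.m_closed[of "winv y" "winv z"] winv_closed[OF y(1)] winv_closed[OF z(1)] by (simp add: x_def)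
  have "\<phi> g = reduce (winv x @ g @ x)" if g: "g \<in> carrier ?G" for g
  proof -
    have "g = conjugate x \<phi> g"
      using eq[OF g] \<open>r\<close> g
      by (simp add: f_def \<phi>2_def \<phi>1_def conjugate_conjugate x_def carrier_free_group reduce_reduced)
    then have "reduce (winv x @ g @ x) = reduce (winv x @ reduce (x @ \<phi> g @ winv x) @ x)"
      by (simp add: conjugate_def)
    also have "\<dots> = reduce (\<phi> g)"
      using reduce_conj_cancel[of x "\<phi> g"]
        reduce_cong_append[OF refl reduce_append_left[of "x @ \<phi> g @ winv x" x], of "winv x"]
      by simp
    also have "\<dots> = \<phi> g"
      using pres g hom_in_carrier[of \<phi> ?G ?G g]
      by (simp add: preserves_powers_def carrier_free_group reduce_reduced)
    finally show ?thesis ..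
  qed
  with x show ?thesis
    by blast
qed

section \<open>Inner automorphisms and rank one\<close>

lemma (in word_metric) word_dist_conj:
  assumes "x \<in> carrier G" "g \<in> carrier G" "h \<in> carrier G"
  shows "\<bar>word_dist G B (inv x \<otimes> g \<otimes> x) (inv x \<otimes> h \<otimes> x) - word_dist G B g h\<bar> \<le> 2 * len x"
proof -
  define k where "k = inv g \<otimes> h"
  define k' where "k' = inv x \<otimes> k \<otimes> x"
  have mem: "k \<in> carrier G" "k' \<in> carrier G"
    using assms by (simp_all add: k_def k'_def)
  have cancel: "x \<otimes> (inv x \<otimes> w) = w" if "w \<in> carrier G" for w
    using assms(1) that by (simp flip: m_assoc)
  have "inv (inv x \<otimes> g \<otimes> x) \<otimes> (inv x \<otimes> h \<otimes> x) = k'"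
    using assms by (simp add: k_def k'_def inv_mult_group m_assoc cancel)
  then have 1: "word_dist G B (inv x \<otimes> g \<otimes> x) (inv x \<otimes> h \<otimes> x) = len k'"
    by (simp add: word_dist_def)
  have "len k' \<le> len (inv x \<otimes> k) + len x" "len (inv x \<otimes> k) \<le> len (inv x) + len k"
    unfolding k'_def using mem assms by (simp_all only: len_mult m_closed inv_closed)
  then have le: "len k' \<le> len k + 2 * len x"
    using assms by simp
  have "k = x \<otimes> k' \<otimes> inv x"
    using assms mem unfolding k'_def by (simp add: m_assoc cancel)
  then have "len k \<le> len (x \<otimes> k') + len (inv x)"
    using len_mult[of "x \<otimes> k'" "inv x"] assms mem by simp
  also have "\<dots> \<le> len x + len k' + len x"
    using len_mult[of x k'] assms mem by simp
  finally show ?thesis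
    using le unfolding 1 by (simp add: abs_le_iff word_dist_def flip: k_def)
qed

lemma reduced_single_letter:
  assumes "reduced w" "fst ` set w \<subseteq> {a}"
  shows "\<exists>n s. w = replicate n (a, s)"
  using assms
proof (induction w)
  case (Cons x w)
  then obtain n s where w: "w = replicate n (a, s)"
    by (auto simp: reduced_Cons)
  obtain t where x: "x = (a, t)"
    using Cons.prems by (cases x) auto
  show ?case
  proof (cases n)
    case 0
    then show ?thesis
      using w x by (intro exI[of _ 1] exI[of _ t]) simp
  next
    case (Suc m)
    then have "s = t"
      using Cons.prems w x by (auto simp: reduced_Cons)
    then show ?thesis
      using w x by (intro exI[of _ "Suc n"] exI[of _ t]) simp
  qed
qed simp

lemma wpow_replicate: "wpow k (replicate n x) = replicate (k * n) x"
  by (induction k) (auto simp: replicate_add)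

lemma auto_rank_one:
  assumes A: "A \<subseteq> {a}" and \<phi>: "\<phi> \<in> hom (free_group A) (free_group A)"
    and surj: "\<phi> ` carrier (free_group A) = carrier (free_group A)"
  shows "(\<forall>g\<in>carrier (free_group A). \<phi> g = g) \<or> (\<forall>g\<in>carrier (free_group A). \<phi> g = winv g)"
proof (cases "a \<in> A")
  case False
  then have "carrier (free_group A) = {[]}"
    using A by (cases "A = {}") (auto simp: free_group_def)
  then show ?thesis
    using surj by auto
next
  case True
  let ?G = "free_group A"
  interpret \<phi>: group_hom ?G ?G \<phi>
    using \<phi> by (simp add: group_hom_def group_hom_axioms_def group_free_group)
  have rep: "\<exists>n s. g = replicate n (a, s)" if "g \<in> carrier ?G" for g
    using that A by (intro reduced_single_letter) (auto simp: carrier_free_group)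
  have red: "reduced (replicate n (a, s))" for n s
    by (simp add: reduced_def successively_conv_nth)
  have mem: "[(a, s)] \<in> carrier ?G" for s
    using True by (simp add: carrier_free_group)
  obtain n t where n: "\<phi> [(a, True)] = replicate n (a, t)"
    using rep[OF \<phi>.hom_closed[OF mem]] by blast
  have letter: "\<phi> [(a, s)] = replicate n (a, s = t)" for s
  proof (cases s)
    case False
    have "[(a, False)] = inv\<^bsub>?G\<^esub> [(a, True)]"
      using mem by (simp add: inv_free_group)
    then have "\<phi> [(a, False)] = winv (replicate n (a, t))"
      using \<phi>.hom_inv[OF mem, of True] inv_free_group[OF \<phi>.hom_closed[OF mem], of True] n by simp
    then show ?thesis
      using False by (simp add: winv_def)
  qed (use n in simp)
  have \<phi>_rep: "\<phi> (replicate k (a, s)) = replicate (k * n) (a, s = t)" for k s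
  proof -
    have "replicate k (a, s) = [(a, s)] [^]\<^bsub>?G\<^esub> k"
      using wpow_replicate[of k 1 "(a, s)"] red by (simp add: pow_free_group reduce_reduced)
    then have "\<phi> (replicate k (a, s)) = \<phi> [(a, s)] [^]\<^bsub>?G\<^esub> k"
      using mem by (simp add: \<phi>.hom_nat_pow)
    then show ?thesis
      using red by (simp add: letter pow_free_group wpow_replicate reduce_reduced)
  qed
  obtain g where "g \<in> carrier ?G" "\<phi> g = [(a, True)]"
    using surj mem by (metis imageE)
  then obtain k s where "replicate (k * n) (a, s = t) = [(a, True)]"
    using rep \<phi>_rep by metis
  then have "length (replicate (k * n) (a, s = t)) = 1"
    by simp
  then have "n = 1"
    by simp
  show ?thesis
  proof (cases t)
    case True
    then show ?thesis
      using rep \<phi>_rep \<open>n = 1\<close> by fastforce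
  next
    case False
    then have "\<phi> g = winv g" if "g \<in> carrier ?G" for g
      using rep[OF that] \<phi>_rep \<open>n = 1\<close> by (auto simp: winv_def)
    then show ?thesis
      by blast
  qed
qed

lemma (in free_word_metric) word_dist_winv:
  assumes "A \<subseteq> {a}" "g \<in> carrier (free_group A)" "h \<in> carrier (free_group A)"
  shows "word_dist (free_group A) B (winv g) (winv h) = word_dist (free_group A) B g h"
proof -
  have sub: "fst ` set (g @ winv h) \<subseteq> {a}"
  proof -
    have "fst ` set g \<subseteq> {a}" "fst ` set h \<subseteq> {a}"
      using assms unfolding carrier_free_group by (meson order_trans)+
    then show ?thesis
      by (simp add: image_Un)
  qed
  have "inv\<^bsub>free_group A\<^esub> winv g \<otimes>\<^bsub>free_group A\<^esub> winv h = reduce (g @ winv h)"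
    using assms by (simp add: inv_free_group winv_closed)
  also have "\<dots> = winv (reduce (winv g @ h))"
    using reduce_commute[OF sub] by (simp flip: reduce_winv)
  also have "reduce (winv g @ h) = inv\<^bsub>free_group A\<^esub> g \<otimes>\<^bsub>free_group A\<^esub> h"
    using assms by (simp add: inv_free_group)
  finally have "inv\<^bsub>free_group A\<^esub> winv g \<otimes>\<^bsub>free_group A\<^esub> winv h =
      winv (inv\<^bsub>free_group A\<^esub> g \<otimes>\<^bsub>free_group A\<^esub> h)" .
  then show ?thesis
    unfolding word_dist_def using assms len_winv[of "inv\<^bsub>free_group A\<^esub> g \<otimes>\<^bsub>free_group A\<^esub> h"]
    by (simp del: mult_free_group)
qed

theorem theorem6p5:
  fixes A :: "'a set" and \<phi> :: "'a letter list \<Rightarrow> 'a letter list"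
  assumes "finite A"
    and "\<phi> \<in> auto (free_group A)"
  shows "(\<forall>d. visual_metric (free_group A) d \<longrightarrow>
            satisfies_Lipschitz (carrier (free_group A)) d \<phi>)
         \<longleftrightarrow> \<phi> \<in> inner_autos (free_group A) \<or> card A \<le> 1"
proof
  let ?G = "free_group A"
  have \<phi>: "\<phi> \<in> hom ?G ?G" "\<phi> \<in> extensional (carrier ?G)" "bij_betw \<phi> (carrier ?G) (carrier ?G)"
    using assms(2) by (auto simp: auto_def Bij_def)
  {
    assume Lip: "\<forall>d. visual_metric ?G d \<longrightarrow> satisfies_Lipschitz (carrier ?G) d \<phi>"
    show "\<phi> \<in> inner_autos ?G \<or> card A \<le> 1"
    proof (cases "card A \<le> 1")
      case False
      then obtain a b where ab: "a \<in> A" "b \<in> A" "a \<noteq> b"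
        using assms(1) by (metis One_nat_def card_le_Suc0_iff_eq)
      have "preserves_powers A \<phi>"
        unfolding preserves_powers_def
        using powers_occur_if_Lipschitz[OF assms(1) \<phi>(1)] \<phi> Lip by (auto dest: bij_betw_imp_inj_on)
      then obtain x where x: "x \<in> carrier ?G"
          "\<And>g. g \<in> carrier ?G \<Longrightarrow> \<phi> g = reduce (winv x @ g @ x)"
        using conjugation_if_preserves_powers ab by metis
      have "\<phi> = (\<lambda>g\<in>carrier ?G. inv\<^bsub>?G\<^esub> x \<otimes>\<^bsub>?G\<^esub> g \<otimes>\<^bsub>?G\<^esub> x)"
      proof (rule extensionalityI[OF \<phi>(2)])
        fix g assume "g \<in> carrier ?G"
        then show "\<phi> g = (\<lambda>g\<in>carrier ?G. inv\<^bsub>?G\<^esub> x \<otimes>\<^bsub>?G\<^esub> g \<otimes>\<^bsub>?G\<^esub> x) g"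
          using x reduce_append_left[of "winv x @ g" x] by (simp add: inv_free_group)
      qed simp
      then show ?thesis
        using x(1) unfolding inner_autos_def by blast
    qed simp
  next
    assume R: "\<phi> \<in> inner_autos ?G \<or> card A \<le> 1"
    show "\<forall>d. visual_metric ?G d \<longrightarrow> satisfies_Lipschitz (carrier ?G) d \<phi>"
    proof (intro allI impI)
      fix d assume "visual_metric ?G d"
      then obtain B p \<gamma> T where B: "finite_generating_set ?G B" and p: "p \<in> carrier ?G"
          and pos: "\<gamma> > 0" "T \<ge> 1" and d: "d \<in> visual_metrics ?G B p \<gamma> T"
        unfolding visual_metric_def by blast
      interpret free_word_metric A B
        unfolding free_word_metric_def word_metric_def word_metric_axioms_def
        using B group_free_group by blast
      have "\<exists>C. \<forall>g\<in>carrier ?G. \<forall>h\<in>carrier ?G.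
          \<bar>word_dist ?G B (\<phi> g) (\<phi> h) - word_dist ?G B g h\<bar> \<le> C"
        using R
      proof
        assume "\<phi> \<in> inner_autos ?G"
        then obtain x where "x \<in> carrier ?G" "\<phi> = (\<lambda>g\<in>carrier ?G. inv\<^bsub>?G\<^esub> x \<otimes>\<^bsub>?G\<^esub> g \<otimes>\<^bsub>?G\<^esub> x)"
          unfolding inner_autos_def by blast
        then show ?thesis
          using word_dist_conj[of x] by (intro exI[of _ "2 * real (len x)"]) (simp del: mult_free_group)
      next
        assume "card A \<le> 1"
        then obtain a where a: "A \<subseteq> {a}"
          using assms(1) by (metis One_nat_def card_le_Suc0_iff_eq insertI1 subsetI singleton_iff)
        then show ?thesis
          using auto_rank_one[OF a \<phi>(1) bij_betw_imp_surj_on[OF \<phi>(3)]] word_dist_winv[OF a]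
          by (intro exI[of _ 0]) auto
      qed
      then obtain C where "\<And>g h. g \<in> carrier ?G \<Longrightarrow> h \<in> carrier ?G \<Longrightarrow>
          \<bar>word_dist ?G B (\<phi> g) (\<phi> h) - word_dist ?G B g h\<bar> \<le> C"
        by blast
      then show "satisfies_Lipschitz (carrier ?G) d \<phi>"
        using Lipschitz_if_quasi_isometric[OF d p pos] hom_in_carrier[OF \<phi>(1)] by blast
    qed
  }
qed

end
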